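(* Let $\iota: R\to A$ be a Frobenius extension and let $m\geq1$. Then the ring homomorphism of $m\times m$ matrix rings $M_m(R)\to M_m(A)$ (given by applying $\iota$ entrywise) is a Frobenius extension.
   Context: All rings are associative with unit. A ring extension $\iota:R\to A$ is a unital ring homomorphism. It is a Frobenius extension if $A$ is finitely generated projective as a left $R$-module and $A\cong\operatorname{Hom}_R(A,R)$ (left $R$-module homomorphisms) as $A$-$R$-bimodules, where $(af)(x)=f(xa)$ and $(fr)(x)=f(x)r$. *)

theory Defs
  imports
    "HOL-Algebra.RingHom"
    "HOL-Algebra.Module"
    "Jordan_Normal_Form.Matrix"
begin

section \<open>Left modules over a not necessarily commutative ring\<close>

text \<open>
  Left modules are represented by the record type of \<^theory>\<open>HOL-Algebra.Module\<close> (its ring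
  multiplication and unit are irrelevant here).  The library locale \<^locale>\<open>module\<close> is not used
  because it requires the scalars to be commutative; \<^locale>\<open>submodule\<close> has no such requirement.
\<close>

text \<open>Homomorphisms are extensional functions, so that equality of homomorphisms is HOL equality.\<close>

definition left_hom ::
  "('a, 'r) ring_scheme \<Rightarrow> ('a, 'b, 'm) module_scheme \<Rightarrow> ('a, 'c, 'n) module_scheme \<Rightarrow> ('b \<Rightarrow> 'c) set"
  where
  "left_hom R M N = {f \<in> carrier M \<rightarrow>\<^sub>E carrier N.
     (\<forall>x\<in>carrier M. \<forall>y\<in>carrier M. f (x \<oplus>\<^bsub>M\<^esub> y) = f x \<oplus>\<^bsub>N\<^esub> f y) \<and>
     (\<forall>a\<in>carrier R. \<forall>x\<in>carrier M. f (a \<odot>\<^bsub>M\<^esub> x) = a \<odot>\<^bsub>N\<^esub> f x)}"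

definition finitely_generated_module ::
  "('a, 'r) ring_scheme \<Rightarrow> ('a, 'b, 'm) module_scheme \<Rightarrow> bool" where
  "finitely_generated_module R M \<longleftrightarrow>
     (\<exists>S. finite S \<and> S \<subseteq> carrier M \<and>
       (\<forall>x\<in>carrier M. \<exists>c\<in>S \<rightarrow> carrier R. x = (\<Oplus>\<^bsub>M\<^esub>s\<in>S. c s \<odot>\<^bsub>M\<^esub> s)))"

definition free_module ::
  "('a, 'r) ring_scheme \<Rightarrow> 'i set \<Rightarrow> ('a, 'i \<Rightarrow> 'a) module" where
  "free_module R I =
    \<lparr>carrier = {f \<in> I \<rightarrow>\<^sub>E carrier R. finite {i \<in> I. f i \<noteq> \<zero>\<^bsub>R\<^esub>}},
     monoid.mult = undefined, one = undefined,
     zero = (\<lambda>i\<in>I. \<zero>\<^bsub>R\<^esub>),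
     add = (\<lambda>f g. \<lambda>i\<in>I. f i \<oplus>\<^bsub>R\<^esub> g i),
     smult = (\<lambda>a f. \<lambda>i\<in>I. a \<otimes>\<^bsub>R\<^esub> f i)\<rparr>"

definition direct_summand ::
  "('a, 'r) ring_scheme \<Rightarrow> 'b set \<Rightarrow> ('a, 'b, 'm) module_scheme \<Rightarrow> bool" where
  "direct_summand R N F \<longleftrightarrow> submodule N R F \<and>
     (\<exists>Q. submodule Q R F \<and> N \<inter> Q = {\<zero>\<^bsub>F\<^esub>} \<and> N <+>\<^bsub>F\<^esub> Q = carrier F)"

text \<open>
  A left module is projective if it is isomorphic to a direct summand of a free module.
  Letting the index set range over sets of elements of the type underlying \<open>M\<close> is no restriction:
  \<open>M\<close> is a quotient of the free module on \<open>carrier M\<close>, and if \<open>M\<close> is a direct summand of any free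
  module at all, then this quotient splits.
\<close>

definition projective_module ::
  "('a, 'r) ring_scheme \<Rightarrow> ('a, 'b, 'm) module_scheme \<Rightarrow> bool" where
  "projective_module R M \<longleftrightarrow>
     (\<exists>(I :: 'b set) N f. direct_summand R N (free_module R I) \<and>
        f \<in> left_hom R M ((free_module R I)\<lparr>carrier := N\<rparr>) \<and> bij_betw f (carrier M) N)"

section \<open>Bimodules\<close>

text \<open>\<open>smult\<close> is the left action, by the first type of scalars, and \<open>rsmult\<close> the right action,
  by the second one.\<close>

record ('a, 'b, 'c) bimodule = "('a, 'b) module" +
  rsmult :: "'b \<Rightarrow> 'c \<Rightarrow> 'b"

definition bimodule_iso ::
  "('a, 'p) ring_scheme \<Rightarrow> ('c, 'r) ring_scheme \<Rightarrow> ('a, 'x, 'c, 'm) bimodule_scheme \<Rightarrow>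
   ('a, 'y, 'c, 'n) bimodule_scheme \<Rightarrow> ('x \<Rightarrow> 'y) set" where
  "bimodule_iso A R M N = {\<Phi> \<in> left_hom A M N.
     (\<forall>x\<in>carrier M. \<forall>r\<in>carrier R. \<Phi> (rsmult M x r) = rsmult N (\<Phi> x) r) \<and>
     bij_betw \<Phi> (carrier M) (carrier N)}"

section \<open>Frobenius extensions\<close>

text \<open>The ring \<open>A\<close> as a left \<open>R\<close>-module via \<open>\<iota>\<close>; for \<open>\<iota> = (\<lambda>x. x)\<close> this is the left regular module.\<close>

definition restrict_scalars ::
  "('r \<Rightarrow> 'a) \<Rightarrow> ('a, 'p) ring_scheme \<Rightarrow> ('r, 'a) module" where
  "restrict_scalars \<iota> A =
    \<lparr>carrier = carrier A, monoid.mult = monoid.mult A, one = one A, zero = zero A, add = add A,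
     smult = (\<lambda>r a. \<iota> r \<otimes>\<^bsub>A\<^esub> a)\<rparr>"

text \<open>The ring \<open>A\<close> as an \<open>A\<close>-\<open>R\<close>-bimodule, \<open>R\<close> acting via \<open>\<iota>\<close>.\<close>

definition extension_bimodule ::
  "('a, 'p) ring_scheme \<Rightarrow> ('r \<Rightarrow> 'a) \<Rightarrow> ('a, 'a, 'r) bimodule" where
  "extension_bimodule A \<iota> =
    \<lparr>carrier = carrier A, monoid.mult = monoid.mult A, one = one A, zero = zero A, add = add A,
     smult = monoid.mult A, rsmult = (\<lambda>a r. a \<otimes>\<^bsub>A\<^esub> \<iota> r)\<rparr>"

text \<open>The left \<open>R\<close>-module homomorphisms from \<open>A\<close> to \<open>R\<close> as an \<open>A\<close>-\<open>R\<close>-bimodule.\<close>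

definition dual_bimodule ::
  "('r, 'q) ring_scheme \<Rightarrow> ('a, 'p) ring_scheme \<Rightarrow> ('r \<Rightarrow> 'a) \<Rightarrow> ('a, 'a \<Rightarrow> 'r, 'r) bimodule" where
  "dual_bimodule R A \<iota> =
    \<lparr>carrier = left_hom R (restrict_scalars \<iota> A) (restrict_scalars (\<lambda>x. x) R),
     monoid.mult = undefined, one = undefined,
     zero = (\<lambda>x\<in>carrier A. \<zero>\<^bsub>R\<^esub>),
     add = (\<lambda>f g. \<lambda>x\<in>carrier A. f x \<oplus>\<^bsub>R\<^esub> g x),
     smult = (\<lambda>a f. \<lambda>x\<in>carrier A. f (x \<otimes>\<^bsub>A\<^esub> a)),
     rsmult = (\<lambda>f r. \<lambda>x\<in>carrier A. f x \<otimes>\<^bsub>R\<^esub> r)\<rparr>"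

definition frobenius_extension ::
  "('r, 'q) ring_scheme \<Rightarrow> ('a, 'p) ring_scheme \<Rightarrow> ('r \<Rightarrow> 'a) \<Rightarrow> bool" where
  "frobenius_extension R A \<iota> \<longleftrightarrow>
     ring_hom_ring R A \<iota> \<and>
     finitely_generated_module R (restrict_scalars \<iota> A) \<and>
     projective_module R (restrict_scalars \<iota> A) \<and>
     bimodule_iso A R (extension_bimodule A \<iota>) (dual_bimodule R A \<iota>) \<noteq> {}"

section \<open>Matrix rings\<close>

text \<open>
  The library's ring of square matrices takes its entries from a type class; here the
  entries come from the carrier of an arbitrary ring.
\<close>

definition matrix_ring :: "nat \<Rightarrow> ('a, 'r) ring_scheme \<Rightarrow> 'a mat ring" where
  "matrix_ring m R =
    \<lparr>carrier = {X \<in> carrier_mat m m. elements_mat X \<subseteq> carrier R},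
     monoid.mult = (\<lambda>X Y. mat m m (\<lambda>(i, j). \<Oplus>\<^bsub>R\<^esub>k\<in>{..<m}. X $$ (i, k) \<otimes>\<^bsub>R\<^esub> Y $$ (k, j))),
     one = mat m m (\<lambda>(i, j). if i = j then \<one>\<^bsub>R\<^esub> else \<zero>\<^bsub>R\<^esub>),
     zero = mat m m (\<lambda>(i, j). \<zero>\<^bsub>R\<^esub>),
     add = (\<lambda>X Y. mat m m (\<lambda>(i, j). X $$ (i, j) \<oplus>\<^bsub>R\<^esub> Y $$ (i, j)))\<rparr>"

end

theory Submission
  imports Defs
begin

text \<open>
  A ring extension \<open>\<iota> : R \<rightarrow> A\<close> is Frobenius iff it has a Frobenius system: an \<open>R\<close>-\<open>R\<close>-bilinear map
  \<open>E : A \<rightarrow> R\<close> and finitely many \<open>x\<^sub>i, y\<^sub>i \<in> A\<close> with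
  \<open>\<Sum>\<^sub>i \<iota>(E(a y\<^sub>i)) x\<^sub>i = a = \<Sum>\<^sub>i y\<^sub>i \<iota>(E(x\<^sub>i a))\<close> for all \<open>a\<close>.  Given a bimodule isomorphism
  \<open>\<Phi> : A \<rightarrow> Hom\<^sub>R(A, R)\<close> and a dual basis \<open>(x\<^sub>i, \<phi>\<^sub>i)\<close> of the finitely generated projective module \<open>A\<close>,
  take \<open>E = \<Phi>(1)\<close> and \<open>\<Phi>(y\<^sub>i) = \<phi>\<^sub>i\<close>; conversely \<open>\<Phi>(a)(x) = E(x a)\<close>.  A Frobenius system of
  \<open>A\<close> over \<open>R\<close> yields one of the matrix rings: \<open>E\<close> applied entrywise, together with the matrices
  \<open>x\<^sub>i e\<^sub>0\<^sub>k\<close> and \<open>y\<^sub>i e\<^sub>k\<^sub>0\<close>.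
\<close>

section \<open>Finite sums\<close>

lemma (in abelian_monoid) finsum_swap:
  assumes "finite I" "finite J" "\<And>i j. i \<in> I \<Longrightarrow> j \<in> J \<Longrightarrow> f i j \<in> carrier G"
  shows "(\<Oplus>i\<in>I. \<Oplus>j\<in>J. f i j) = (\<Oplus>j\<in>J. \<Oplus>i\<in>I. f i j)"
  using assms(1,3)
proof (induction I)
  case (insert i I)
  have "(\<Oplus>k\<in>insert i I. \<Oplus>j\<in>J. f k j) = (\<Oplus>j\<in>J. f i j) \<oplus> (\<Oplus>j\<in>J. \<Oplus>k\<in>I. f k j)"
    using insert by (subst finsum_insert) (auto simp: Pi_def intro!: finsum_closed)
  also have "\<dots> = (\<Oplus>j\<in>J. f i j \<oplus> (\<Oplus>k\<in>I. f k j))"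
    using insert.prems by (intro finsum_addf[symmetric]) (auto simp: Pi_def intro!: finsum_closed)
  also have "\<dots> = (\<Oplus>j\<in>J. \<Oplus>k\<in>insert i I. f k j)"
    using insert by (intro finsum_cong') (auto simp: Pi_def intro!: finsum_closed)
  finally show ?case .
qed simp

lemma (in abelian_monoid) finsum_Times:
  assumes "finite I" "finite J" "f \<in> I \<times> J \<rightarrow> carrier G"
  shows "(\<Oplus>p\<in>I \<times> J. f p) = (\<Oplus>i\<in>I. \<Oplus>j\<in>J. f (i, j))"
proof -
  have "I \<times> J = (\<Union>i\<in>I. Pair i ` J)" by auto
  then have "(\<Oplus>p\<in>I \<times> J. f p) = (\<Oplus>i\<in>I. finsum G f (Pair i ` J))"
    using assms add.finprod_UN_disjoint[of I "\<lambda>i. Pair i ` J" f]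
    by (auto simp: pairwise_def disjnt_def)
  also have "\<dots> = (\<Oplus>i\<in>I. \<Oplus>j\<in>J. f (i, j))"
  proof (intro finsum_cong')
    fix i assume "i \<in> I"
    then show "finsum G f (Pair i ` J) = (\<Oplus>j\<in>J. f (i, j))"
      using assms(3) by (subst finsum_reindex) (auto simp: inj_on_def)
  qed (use assms in \<open>auto simp: Pi_def intro!: finsum_closed\<close>)
  finally show ?thesis .
qed

text \<open>The fibres of \<open>x\<close> partition \<open>I\<close>. This serves to merge those
  members of a dual basis that share the same vector.\<close>

lemma (in abelian_monoid) finsum_fibres:
  assumes "finite I" "\<And>i. i \<in> I \<Longrightarrow> f i \<in> carrier G"
  shows "(\<Oplus>s\<in>x ` I. \<Oplus>i\<in>{i \<in> I. x i = s}. f i) = (\<Oplus>i\<in>I. f i)"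
proof -
  have "I = (\<Union>s\<in>x ` I. {i \<in> I. x i = s})" by auto
  moreover have "pairwise (\<lambda>s t. disjnt {i \<in> I. x i = s} {i \<in> I. x i = t}) (x ` I)"
    by (auto simp: pairwise_def disjnt_def)
  ultimately show ?thesis
    using assms add.finprod_UN_disjoint[of "x ` I" "\<lambda>s. {i \<in> I. x i = s}" f] by simp
qed

lemma (in abelian_group_hom) hom_finsum:
  assumes "\<And>i. i \<in> I \<Longrightarrow> f i \<in> carrier G"
  shows "h (\<Oplus>\<^bsub>G\<^esub>i\<in>I. f i) = (\<Oplus>\<^bsub>H\<^esub>i\<in>I. h (f i))"
proof (cases "finite I")
  case True
  then show ?thesis
    using assms by (induction I) (auto simp: Pi_def)
\<comment> \<open>For infinite \<open>I\<close> both sums take the default value zero, which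
  \<open>h\<close> preserves.\<close>
qed auto

lemma abelian_group_homI:
  assumes "abelian_group G" "abelian_group H" "\<And>x. x \<in> carrier G \<Longrightarrow> h x \<in> carrier H"
    "\<And>x y. x \<in> carrier G \<Longrightarrow> y \<in> carrier G \<Longrightarrow> h (x \<oplus>\<^bsub>G\<^esub> y) = h x \<oplus>\<^bsub>H\<^esub> h y"
  shows "abelian_group_hom G H h"
  using assms
  by (auto simp: abelian_group_hom_def abelian_group_hom_axioms_def group_hom_def
      group_hom_axioms_def hom_def abelian_group.a_group)

section \<open>Left modules\<close>

text \<open>The scalars may be noncommutative, which the locale \<open>module\<close> rules
  out.\<close>

locale left_module = R?: ring R + M?: abelian_group M
  for R :: "('a, 'r) ring_scheme" (structure) and M :: "('a, 'b, 'm) module_scheme" (structure) +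
  assumes smult_closed [simp, intro]: "a \<in> carrier R \<Longrightarrow> x \<in> carrier M \<Longrightarrow> a \<odot>\<^bsub>M\<^esub> x \<in> carrier M"
    and smult_l_distr: "a \<in> carrier R \<Longrightarrow> b \<in> carrier R \<Longrightarrow> x \<in> carrier M \<Longrightarrow>
      (a \<oplus>\<^bsub>R\<^esub> b) \<odot>\<^bsub>M\<^esub> x = a \<odot>\<^bsub>M\<^esub> x \<oplus>\<^bsub>M\<^esub> b \<odot>\<^bsub>M\<^esub> x"
    and smult_r_distr: "a \<in> carrier R \<Longrightarrow> x \<in> carrier M \<Longrightarrow> y \<in> carrier M \<Longrightarrow>
      a \<odot>\<^bsub>M\<^esub> (x \<oplus>\<^bsub>M\<^esub> y) = a \<odot>\<^bsub>M\<^esub> x \<oplus>\<^bsub>M\<^esub> a \<odot>\<^bsub>M\<^esub> y"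
    and smult_assoc: "a \<in> carrier R \<Longrightarrow> b \<in> carrier R \<Longrightarrow> x \<in> carrier M \<Longrightarrow>
      (a \<otimes>\<^bsub>R\<^esub> b) \<odot>\<^bsub>M\<^esub> x = a \<odot>\<^bsub>M\<^esub> (b \<odot>\<^bsub>M\<^esub> x)"
    and smult_one [simp]: "x \<in> carrier M \<Longrightarrow> \<one>\<^bsub>R\<^esub> \<odot>\<^bsub>M\<^esub> x = x"
begin

lemma abelian_group_hom_smult: "a \<in> carrier R \<Longrightarrow> abelian_group_hom M M ((\<odot>\<^bsub>M\<^esub>) a)"
  by (intro abelian_group_homI) (auto simp: smult_r_distr M.abelian_group_axioms)

lemma abelian_group_hom_smult_left: "x \<in> carrier M \<Longrightarrow> abelian_group_hom R M (\<lambda>a. a \<odot>\<^bsub>M\<^esub> x)"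
  by (intro abelian_group_homI) (auto simp: smult_l_distr M.abelian_group_axioms R.abelian_group_axioms)

lemma smult_r_zero [simp]: "a \<in> carrier R \<Longrightarrow> a \<odot>\<^bsub>M\<^esub> \<zero>\<^bsub>M\<^esub> = \<zero>\<^bsub>M\<^esub>"
  by (rule abelian_group_hom.hom_zero[OF abelian_group_hom_smult])

lemma smult_l_zero [simp]: "x \<in> carrier M \<Longrightarrow> \<zero>\<^bsub>R\<^esub> \<odot>\<^bsub>M\<^esub> x = \<zero>\<^bsub>M\<^esub>"
  by (rule abelian_group_hom.hom_zero[OF abelian_group_hom_smult_left])

lemma submoduleI:
  assumes "H \<subseteq> carrier M" "\<zero>\<^bsub>M\<^esub> \<in> H" "\<And>x. x \<in> H \<Longrightarrow> \<ominus>\<^bsub>M\<^esub> x \<in> H"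
    "\<And>x y. x \<in> H \<Longrightarrow> y \<in> H \<Longrightarrow> x \<oplus>\<^bsub>M\<^esub> y \<in> H"
    "\<And>a x. a \<in> carrier R \<Longrightarrow> x \<in> H \<Longrightarrow> a \<odot>\<^bsub>M\<^esub> x \<in> H"
  shows "submodule H R M"
  using assms by (auto simp: submodule_def subgroup_def submodule_axioms_def a_inv_def)

end

lemma submoduleD:
  assumes "submodule H R M"
  shows "H \<subseteq> carrier M" "\<zero>\<^bsub>M\<^esub> \<in> H" "\<And>x. x \<in> H \<Longrightarrow> \<ominus>\<^bsub>M\<^esub> x \<in> H"
    "\<And>x y. x \<in> H \<Longrightarrow> y \<in> H \<Longrightarrow> x \<oplus>\<^bsub>M\<^esub> y \<in> H"
    "\<And>a x. a \<in> carrier R \<Longrightarrow> x \<in> H \<Longrightarrow> a \<odot>\<^bsub>M\<^esub> x \<in> H"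
  using assms by (auto simp: submodule_def subgroup_def submodule_axioms_def a_inv_def)

lemma left_homI:
  assumes "f \<in> carrier M \<rightarrow>\<^sub>E carrier N"
    "\<And>x y. x \<in> carrier M \<Longrightarrow> y \<in> carrier M \<Longrightarrow> f (x \<oplus>\<^bsub>M\<^esub> y) = f x \<oplus>\<^bsub>N\<^esub> f y"
    "\<And>a x. a \<in> carrier R \<Longrightarrow> x \<in> carrier M \<Longrightarrow> f (a \<odot>\<^bsub>M\<^esub> x) = a \<odot>\<^bsub>N\<^esub> f x"
  shows "f \<in> left_hom R M N"
  using assms by (auto simp: left_hom_def)

lemma left_homD:
  assumes "f \<in> left_hom R M N"
  shows "\<And>x. x \<in> carrier M \<Longrightarrow> f x \<in> carrier N" "f \<in> extensional (carrier M)"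
    "\<And>x y. x \<in> carrier M \<Longrightarrow> y \<in> carrier M \<Longrightarrow> f (x \<oplus>\<^bsub>M\<^esub> y) = f x \<oplus>\<^bsub>N\<^esub> f y"
    "\<And>a x. a \<in> carrier R \<Longrightarrow> x \<in> carrier M \<Longrightarrow> f (a \<odot>\<^bsub>M\<^esub> x) = a \<odot>\<^bsub>N\<^esub> f x"
  using assms by (auto simp: left_hom_def PiE_def)

lemma left_hom_abelian_group_hom:
  assumes "f \<in> left_hom R M N" "left_module R M" "left_module R N"
  shows "abelian_group_hom M N f"
  using assms left_homD[OF assms(1)]
  by (intro abelian_group_homI) (auto simp: left_module_def)

lemma left_hom_finsum_smult:
  assumes f: "f \<in> left_hom R M N" and M: "left_module R M" and N: "left_module R N"
    and "\<And>i. i \<in> I \<Longrightarrow> c i \<in> carrier R" "\<And>i. i \<in> I \<Longrightarrow> x i \<in> carrier M"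
  shows "f (\<Oplus>\<^bsub>M\<^esub>i\<in>I. c i \<odot>\<^bsub>M\<^esub> x i) = (\<Oplus>\<^bsub>N\<^esub>i\<in>I. c i \<odot>\<^bsub>N\<^esub> f (x i))"
proof -
  interpret M: left_module R M by (rule M)
  interpret N: left_module R N by (rule N)
  interpret f: abelian_group_hom M N f by (rule left_hom_abelian_group_hom[OF f M N])
  have "f (\<Oplus>\<^bsub>M\<^esub>i\<in>I. c i \<odot>\<^bsub>M\<^esub> x i) = (\<Oplus>\<^bsub>N\<^esub>i\<in>I. f (c i \<odot>\<^bsub>M\<^esub> x i))"
    using assms by (intro f.hom_finsum) auto
  also have "\<dots> = (\<Oplus>\<^bsub>N\<^esub>i\<in>I. c i \<odot>\<^bsub>N\<^esub> f (x i))"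
    using assms left_homD[OF f] by (intro N.finsum_cong') auto
  finally show ?thesis .
qed

subsection \<open>Restriction of scalars\<close>

lemma restrict_scalars_simps [simp]:
  "carrier (restrict_scalars \<iota> A) = carrier A" "zero (restrict_scalars \<iota> A) = zero A"
  "add (restrict_scalars \<iota> A) = add A" "smult (restrict_scalars \<iota> A) r a = \<iota> r \<otimes>\<^bsub>A\<^esub> a"
  by (simp_all add: restrict_scalars_def)

text \<open>A finite sum depends only on the carrier, the zero and the addition, and these are
  copied from \<open>A\<close>.\<close>

lemma finsum_restrict_scalars [simp]: "finsum (restrict_scalars \<iota> A) = finsum A"
  by (intro ext) (simp add: finsum_def finprod_def)

lemma (in ring_hom_ring) left_module_restrict_scalars: "left_module R (restrict_scalars h S)"
proof -
  interpret M: abelian_group "restrict_scalars h S"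
    by (rule abelian_groupI) (auto simp: S.a_ac intro: S.l_neg)
  show ?thesis
    by unfold_locales (auto simp: S.l_distr S.r_distr S.m_assoc)
qed

lemma (in ring) left_module_regular: "left_module R (restrict_scalars (\<lambda>x. x) R)"
  by (intro ring_hom_ring.left_module_restrict_scalars ring_hom_ringI ring_axioms) auto

subsection \<open>Free modules\<close>

lemma free_module_simps [simp]:
  "carrier (free_module R I) = {f \<in> I \<rightarrow>\<^sub>E carrier R. finite {i \<in> I. f i \<noteq> \<zero>\<^bsub>R\<^esub>}}"
  "zero (free_module R I) = (\<lambda>i\<in>I. \<zero>\<^bsub>R\<^esub>)"
  "add (free_module R I) = (\<lambda>f g. \<lambda>i\<in>I. f i \<oplus>\<^bsub>R\<^esub> g i)"
  "smult (free_module R I) = (\<lambda>a f. \<lambda>i\<in>I. a \<otimes>\<^bsub>R\<^esub> f i)"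
  by (simp_all add: free_module_def)

lemma (in ring) left_module_free_module: "left_module R (free_module R I)"
proof -
  have fin_add: "finite {i \<in> I. f i \<oplus> g i \<noteq> \<zero>}"
    if "finite {i \<in> I. f i \<noteq> \<zero>}" "finite {i \<in> I. g i \<noteq> \<zero>}" for f g :: "'c \<Rightarrow> 'a"
    by (rule finite_subset[OF _ finite_UnI[OF that]]) auto
  have fin_smult: "finite {i \<in> I. a \<otimes> f i \<noteq> \<zero>}"
    if "finite {i \<in> I. f i \<noteq> \<zero>}" "a \<in> carrier R" for f :: "'c \<Rightarrow> 'a" and a
    by (rule finite_subset[OF _ that(1)]) (use that(2) in auto)
  have fin_minus: "finite {i \<in> I. \<ominus> f i \<noteq> \<zero>}"
    if "finite {i \<in> I. f i \<noteq> \<zero>}" for f :: "'c \<Rightarrow> 'a"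
    by (rule finite_subset[OF _ that]) auto
  have c: "f i \<in> carrier R" if "f \<in> carrier (free_module R I)" "i \<in> I" for f :: "'c \<Rightarrow> 'a" and i
    using that by auto
  \<comment> \<open>The laws \<open>0 + f = f\<close> and \<open>1 f = f\<close> are equalities of
    functions on the whole index type, so the values outside \<open>I\<close> count as well.\<close>
  have undef: "f i = undefined" if "f \<in> carrier (free_module R I)" "i \<notin> I" for f :: "'c \<Rightarrow> 'a" and i
    using that by auto
  interpret F: abelian_group "free_module R I"
  proof (rule abelian_groupI, goal_cases)
    case (1 f g)
    then show ?case using fin_add[of f g]
      by (auto simp: conj_commute cong: conj_cong)
  next
    case (6 f)
    note f = c[OF 6]
    have "finite {i \<in> I. (\<lambda>i\<in>I. \<ominus> f i) i \<noteq> \<zero>}"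
      using 6 fin_minus[of f] by (auto cong: conj_cong)
    then have "(\<lambda>i\<in>I. \<ominus> f i) \<in> carrier (free_module R I)"
      using f by simp
    moreover have "(\<lambda>i\<in>I. \<ominus> f i) \<oplus>\<^bsub>free_module R I\<^esub> f = \<zero>\<^bsub>free_module R I\<^esub>"
      using f by (simp add: fun_eq_iff l_neg)
    ultimately show ?case by blast
  next
    case (3 f g h)
    then show ?case using c[OF 3(1)] c[OF 3(2)] c[OF 3(3)] by (simp add: fun_eq_iff a_assoc)
  next
    case (4 f g)
    then show ?case using c[OF 4(1)] c[OF 4(2)] by (simp add: fun_eq_iff a_comm)
  next
    case (5 f)
    then show ?case using c[OF 5] undef[OF 5] by (simp add: fun_eq_iff restrict_def)
  qed simp
  show ?thesis
  proof (unfold_locales, goal_cases)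
    case (1 a f)
    then show ?case using fin_smult[of f a] by (auto cong: conj_cong)
  next
    case (2 a b f)
    then show ?case using c[OF 2(3)] by (simp add: fun_eq_iff l_distr)
  next
    case (3 a f g)
    then show ?case using c[OF 3(2)] c[OF 3(3)] by (simp add: fun_eq_iff r_distr)
  next
    case (4 a b f)
    then show ?case using c[OF 4(3)] by (simp add: fun_eq_iff m_assoc)
  next
    case (5 f)
    then show ?case using c[OF 5] undef[OF 5] by (simp add: fun_eq_iff restrict_def)
  qed
qed

subsection \<open>Projectivity and dual bases\<close>

text \<open>Every element of \<open>F\<close> splits as \<open>f a\<close> plus an element of a
  complement \<open>Q\<close>. Here \<open>a\<close> is unique because \<open>N\<close> meets
  \<open>Q\<close> trivially and \<open>f\<close> is injective, and the retraction \<open>h\<close>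
  sends the element to \<open>a\<close>.\<close>

lemma direct_summand_retraction:
  assumes M: "left_module R M" and F: "left_module R F" and N: "direct_summand R N F"
    and f: "f \<in> left_hom R M (F\<lparr>carrier := N\<rparr>)" and bij: "bij_betw f (carrier M) N"
  obtains h where "f \<in> left_hom R M F" "h \<in> left_hom R F M" "\<And>a. a \<in> carrier M \<Longrightarrow> h (f a) = a"
proof -
  interpret M: left_module R M by (rule M)
  interpret F: left_module R F by (rule F)
  obtain Q where N': "submodule N R F" and Q: "submodule Q R F" and NQ: "N \<inter> Q = {\<zero>\<^bsub>F\<^esub>}"
    and sum: "N <+>\<^bsub>F\<^esub> Q = carrier F"
    using N by (auto simp: direct_summand_def)
  note N' = submoduleD[OF N'] and Q = submoduleD[OF Q]
  have fF: "f \<in> left_hom R M F"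
    using f N'(1) by (auto simp: left_hom_def PiE_def)
  interpret f: abelian_group_hom M F f
    by (rule left_hom_abelian_group_hom[OF fF M F])
  have fN: "f a \<in> N" if "a \<in> carrier M" for a
    using bij that by (auto simp: bij_betw_def)
  define h where "h = (\<lambda>v\<in>carrier F. THE a. a \<in> carrier M \<and> (\<exists>q\<in>Q. v = f a \<oplus>\<^bsub>F\<^esub> q))"
  have uniq: "a = b" if ab: "a \<in> carrier M" "b \<in> carrier M" and pq: "p \<in> Q" "q \<in> Q"
    and eq: "f a \<oplus>\<^bsub>F\<^esub> p = f b \<oplus>\<^bsub>F\<^esub> q" for a b p q
  proof -
    have c: "f a \<in> carrier F" "f b \<in> carrier F" "p \<in> carrier F" "q \<in> carrier F"
      using ab pq Q(1) by auto
    \<comment> \<open>The equation is rearranged so that a difference of elements of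
      \<open>N\<close> equals a difference of elements of \<open>Q\<close>; the common value must be
      zero.\<close>
    have "f a \<oplus>\<^bsub>F\<^esub> \<ominus>\<^bsub>F\<^esub> f b = (f a \<oplus>\<^bsub>F\<^esub> p) \<oplus>\<^bsub>F\<^esub> (\<ominus>\<^bsub>F\<^esub> p \<oplus>\<^bsub>F\<^esub> \<ominus>\<^bsub>F\<^esub> f b)"
      using c by (simp add: F.M.a_assoc F.M.r_neg2)
    also have "\<dots> = q \<oplus>\<^bsub>F\<^esub> \<ominus>\<^bsub>F\<^esub> p"
      using c unfolding eq by (metis F.M.a_comm F.M.a_assoc F.M.r_neg2 F.M.a_inv_closed F.M.add.m_closed)
    finally have "f a \<oplus>\<^bsub>F\<^esub> \<ominus>\<^bsub>F\<^esub> f b \<in> N \<inter> Q"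
      using N'(3,4) Q(3,4) fN ab pq by (metis IntI)
    then have "f a \<oplus>\<^bsub>F\<^esub> \<ominus>\<^bsub>F\<^esub> f b = \<zero>\<^bsub>F\<^esub>" using NQ by auto
    then have "f a = f b"
      using c by (metis F.M.add.inv_closed F.M.minus_equality F.M.minus_minus)
    then show "a = b" using bij ab by (auto simp: bij_betw_def inj_on_def)
  qed
  \<comment> \<open>Any decomposition of \<open>v\<close> computes \<open>h v\<close>. Additivity
    and linearity of \<open>h\<close> therefore follow by adding and scaling decompositions.\<close>
  have h_eq: "h v = a" if "a \<in> carrier M" "q \<in> Q" "v = f a \<oplus>\<^bsub>F\<^esub> q" for v a q
  proof -
    have "v \<in> carrier F" using that Q(1) by auto
    moreover have "(THE a. a \<in> carrier M \<and> (\<exists>q\<in>Q. v = f a \<oplus>\<^bsub>F\<^esub> q)) = a"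
      using that uniq by (intro the_equality) blast+
    ultimately show ?thesis by (simp add: h_def)
  qed
  have decomp: "\<exists>q\<in>Q. v = f (h v) \<oplus>\<^bsub>F\<^esub> q" "h v \<in> carrier M" if "v \<in> carrier F" for v
  proof -
    from that sum obtain n q where n: "n \<in> N" and q: "q \<in> Q" and v: "v = n \<oplus>\<^bsub>F\<^esub> q"
      unfolding set_add_def' by blast
    from n bij obtain a where a: "a \<in> carrier M" "n = f a" by (auto simp: bij_betw_def)
    have "h v = a" using a q v by (intro h_eq) auto
    then show "\<exists>q\<in>Q. v = f (h v) \<oplus>\<^bsub>F\<^esub> q" "h v \<in> carrier M" using a q v by auto
  qed
  have "h \<in> left_hom R F M"
  proof (rule left_homI)
    show "h \<in> carrier F \<rightarrow>\<^sub>E carrier M" using decomp(2) by (auto simp: h_def PiE_def)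
  next
    fix v w assume vw: "v \<in> carrier F" "w \<in> carrier F"
    obtain p q where pq: "p \<in> Q" "q \<in> Q" "v = f (h v) \<oplus>\<^bsub>F\<^esub> p" "w = f (h w) \<oplus>\<^bsub>F\<^esub> q"
      using decomp(1) vw by metis
    have "p \<in> carrier F" "q \<in> carrier F" using pq Q(1) by auto
    then have "(f (h v) \<oplus>\<^bsub>F\<^esub> p) \<oplus>\<^bsub>F\<^esub> (f (h w) \<oplus>\<^bsub>F\<^esub> q) = f (h v \<oplus>\<^bsub>M\<^esub> h w) \<oplus>\<^bsub>F\<^esub> (p \<oplus>\<^bsub>F\<^esub> q)"
      using decomp(2) vw by (simp add: F.M.a_ac)
    then have "v \<oplus>\<^bsub>F\<^esub> w = f (h v \<oplus>\<^bsub>M\<^esub> h w) \<oplus>\<^bsub>F\<^esub> (p \<oplus>\<^bsub>F\<^esub> q)"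
      using pq(3,4) by simp
    then show "h (v \<oplus>\<^bsub>F\<^esub> w) = h v \<oplus>\<^bsub>M\<^esub> h w"
      using decomp(2) vw pq Q(4) by (intro h_eq) auto
  next
    fix r v assume rv: "r \<in> carrier R" "v \<in> carrier F"
    obtain q where q: "q \<in> Q" "v = f (h v) \<oplus>\<^bsub>F\<^esub> q"
      using decomp(1) rv by metis
    have "q \<in> carrier F" using q Q(1) by auto
    then have "r \<odot>\<^bsub>F\<^esub> (f (h v) \<oplus>\<^bsub>F\<^esub> q) = f (r \<odot>\<^bsub>M\<^esub> h v) \<oplus>\<^bsub>F\<^esub> (r \<odot>\<^bsub>F\<^esub> q)"
      using decomp(2) rv by (simp add: F.smult_r_distr left_homD(4)[OF fF])
    then have "r \<odot>\<^bsub>F\<^esub> v = f (r \<odot>\<^bsub>M\<^esub> h v) \<oplus>\<^bsub>F\<^esub> (r \<odot>\<^bsub>F\<^esub> q)"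
      using q(2) by simp
    then show "h (r \<odot>\<^bsub>F\<^esub> v) = r \<odot>\<^bsub>M\<^esub> h v"
      using decomp(2) rv q Q(5) by (intro h_eq) auto
  qed
  moreover have "h (f a) = a" if "a \<in> carrier M" for a
    using that Q(2) by (intro h_eq) auto
  ultimately show ?thesis using that fF by blast
qed

text \<open>The complement is the kernel \<open>Q\<close> of \<open>h\<close>: every
  \<open>v\<close> is \<open>f (h v)\<close> plus \<open>v - f (h v)\<close>, and \<open>h\<close>
  kills the second term. If \<open>f a\<close> lies in the kernel, then \<open>a = h (f a)\<close>
  is zero.\<close>

lemma retraction_direct_summand:
  assumes M: "left_module R M" and F: "left_module R F"
    and f: "f \<in> left_hom R M F" and h: "h \<in> left_hom R F M"
    and hf: "\<And>a. a \<in> carrier M \<Longrightarrow> h (f a) = a"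
  shows "direct_summand R (f ` carrier M) F"
proof -
  interpret M: left_module R M by (rule M)
  interpret F: left_module R F by (rule F)
  interpret f: abelian_group_hom M F f by (rule left_hom_abelian_group_hom[OF f M F])
  interpret h: abelian_group_hom F M h by (rule left_hom_abelian_group_hom[OF h F M])
  define Q where "Q = {v \<in> carrier F. h v = \<zero>\<^bsub>M\<^esub>}"
  have "submodule (f ` carrier M) R F"
  proof (rule F.submoduleI)
    show "\<zero>\<^bsub>F\<^esub> \<in> f ` carrier M" using f.hom_zero by (metis M.M.zero_closed imageI)
    show "\<ominus>\<^bsub>F\<^esub> x \<in> f ` carrier M" if "x \<in> f ` carrier M" for x
      using that by (auto simp flip: f.hom_a_inv)
    show "x \<oplus>\<^bsub>F\<^esub> y \<in> f ` carrier M" if "x \<in> f ` carrier M" "y \<in> f ` carrier M" for x y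
      using that by (auto simp flip: f.hom_add)
    show "a \<odot>\<^bsub>F\<^esub> x \<in> f ` carrier M" if "a \<in> carrier R" "x \<in> f ` carrier M" for a x
      using that by (auto simp flip: left_homD(4)[OF f])
  qed auto
  moreover have "submodule Q R F"
    by (rule F.submoduleI) (auto simp: Q_def left_homD(4)[OF h])
  moreover have "f ` carrier M \<inter> Q = {\<zero>\<^bsub>F\<^esub>}"
    by (auto simp: Q_def hf intro!: image_eqI[of _ f "\<zero>\<^bsub>M\<^esub>"])
  moreover have "f ` carrier M <+>\<^bsub>F\<^esub> Q = carrier F"
  proof (intro equalityI subsetI)
    fix v assume v: "v \<in> carrier F"
    then have "f (h v) \<oplus>\<^bsub>F\<^esub> (v \<oplus>\<^bsub>F\<^esub> \<ominus>\<^bsub>F\<^esub> f (h v)) = v"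
      by (metis F.M.a_inv_closed F.M.a_comm F.M.r_neg1 F.M.minus_minus f.hom_closed h.hom_closed)
    moreover have "v \<oplus>\<^bsub>F\<^esub> \<ominus>\<^bsub>F\<^esub> f (h v) \<in> Q"
      using v by (auto simp: Q_def hf M.M.r_neg)
    ultimately show "v \<in> f ` carrier M <+>\<^bsub>F\<^esub> Q"
      using v unfolding set_add_def' by (force intro: h.hom_closed)
  qed (auto simp: set_add_def' Q_def)
  ultimately show ?thesis unfolding direct_summand_def by blast
qed

text \<open>Trades submodules and internal sums for a pair of maps, the form in which projectivity
  is used and proved below. The free module keeps the index type \<open>'b\<close> prescribed by
  \<open>projective_module\<close>.\<close>

lemma projective_module_iff_retraction:
  fixes M :: "('a, 'b, 'm) module_scheme"
  assumes "left_module R M"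
  shows "projective_module R M \<longleftrightarrow>
    (\<exists>(I :: 'b set) f h. f \<in> left_hom R M (free_module R I) \<and> h \<in> left_hom R (free_module R I) M \<and>
      (\<forall>a\<in>carrier M. h (f a) = a))"
    (is "_ \<longleftrightarrow> ?rhs")
proof
  interpret M: left_module R M by fact
  have F: "left_module R (free_module R I)" for I :: "'b set"
    by (rule M.left_module_free_module)
  show ?rhs if "projective_module R M"
    using that direct_summand_retraction[OF assms F] unfolding projective_module_def by metis
  show "projective_module R M" if ?rhs
  proof -
    from that obtain f h and I :: "'b set"
      where f: "f \<in> left_hom R M (free_module R I)" and h: "h \<in> left_hom R (free_module R I) M"
      and hf: "\<And>a. a \<in> carrier M \<Longrightarrow> h (f a) = a" by blast
    have "f \<in> left_hom R M ((free_module R I)\<lparr>carrier := f ` carrier M\<rparr>)"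
      using f by (auto simp: left_hom_def PiE_def)
    moreover have "bij_betw f (carrier M) (f ` carrier M)"
      using hf by (auto simp: bij_betw_def intro: inj_on_inverseI)
    moreover have "direct_summand R (f ` carrier M) (free_module R I)"
      using hf by (intro retraction_direct_summand[OF assms F f h])
    ultimately show ?thesis
      unfolding projective_module_def
      by (intro exI[of _ I] exI[of _ "f ` carrier M"] exI[of _ f] conjI)
  qed
qed

section \<open>The dual basis lemma\<close>

text \<open>A dual basis in the sense of projective modules: no independence is required, and
  \<open>x\<close> may repeat vectors. Finiteness of \<open>I\<close> makes it encode finite
  generation and projectivity together.\<close>

definition dual_basis ::
  "('a, 'r) ring_scheme \<Rightarrow> ('a, 'b, 'm) module_scheme \<Rightarrow> 'i set \<Rightarrow> ('i \<Rightarrow> 'b) \<Rightarrow> ('i \<Rightarrow> 'b \<Rightarrow> 'a) \<Rightarrow> bool"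
  where
  "dual_basis R M I x \<phi> \<longleftrightarrow> finite I \<and> x \<in> I \<rightarrow> carrier M \<and>
     \<phi> \<in> I \<rightarrow> left_hom R M (restrict_scalars (\<lambda>x. x) R) \<and>
     (\<forall>a\<in>carrier M. (\<Oplus>\<^bsub>M\<^esub>i\<in>I. \<phi> i a \<odot>\<^bsub>M\<^esub> x i) = a)"

text \<open>Induction on \<open>J\<close>, splitting off one coordinate at a time. \<open>J\<close>
  only has to contain the support of \<open>v\<close>, so one finite set can serve for many vectors
  at once.\<close>

lemma left_hom_free_module_finite_support:
  assumes M: "left_module R M" and h: "h \<in> left_hom R (free_module R I) M"
    and v: "v \<in> carrier (free_module R I)"
    and J: "finite J" "J \<subseteq> I" "\<And>i. i \<in> I - J \<Longrightarrow> v i = \<zero>\<^bsub>R\<^esub>"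
  shows "h v = (\<Oplus>\<^bsub>M\<^esub>j\<in>J. v j \<odot>\<^bsub>M\<^esub> h (\<lambda>i\<in>I. if i = j then \<one>\<^bsub>R\<^esub> else \<zero>\<^bsub>R\<^esub>))"
  using J v
proof (induction J arbitrary: v)
  interpret M: left_module R M by (rule M)
  interpret F: left_module R "free_module R I" by (rule M.left_module_free_module)
  interpret h: abelian_group_hom "free_module R I" M h
    by (rule left_hom_abelian_group_hom[OF h F.left_module_axioms M])
  {
    case empty
    then have "v = \<zero>\<^bsub>free_module R I\<^esub>"
      by (auto simp: fun_eq_iff PiE_def extensional_def)
    then show ?case by (simp del: free_module_simps)
  next
    case (insert j J)
    \<comment> \<open>\<open>?w\<close> is \<open>v\<close> with coordinate \<open>j\<close> erased;
      it vanishes on \<open>I - J\<close>, so the induction hypothesis applies to it.\<close>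
    let ?e = "\<lambda>j. \<lambda>i\<in>I. if i = j then \<one>\<^bsub>R\<^esub> else \<zero>\<^bsub>R\<^esub>" and ?w = "v(j := \<zero>\<^bsub>R\<^esub>)"
    have v: "v i \<in> carrier R" if "i \<in> I" for i using insert.prems that by auto
    have e: "?e j \<in> carrier (free_module R I)" for j
      by (auto intro!: finite_subset[of _ "{j}"] split: if_splits)
    have w: "?w \<in> carrier (free_module R I)"
      using insert.prems
      by (auto simp: PiE_def extensional_def intro: finite_subset[OF _ insert.hyps(1)])
    have "v = (v j \<odot>\<^bsub>free_module R I\<^esub> ?e j) \<oplus>\<^bsub>free_module R I\<^esub> ?w"
      using insert.prems v by (auto simp: fun_eq_iff PiE_def extensional_def)
    then have "h v = h ((v j \<odot>\<^bsub>free_module R I\<^esub> ?e j) \<oplus>\<^bsub>free_module R I\<^esub> ?w)" by simp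
    also have "\<dots> = v j \<odot>\<^bsub>M\<^esub> h (?e j) \<oplus>\<^bsub>M\<^esub> h ?w"
      using e w v insert.prems F.smult_closed[of "v j" "?e j"]
      by (simp add: left_homD(4)[OF h] del: free_module_simps)
    also have "h ?w = (\<Oplus>\<^bsub>M\<^esub>k\<in>J. ?w k \<odot>\<^bsub>M\<^esub> h (?e k))"
      using insert.prems w by (intro insert.IH) auto
    also have "\<dots> = (\<Oplus>\<^bsub>M\<^esub>k\<in>J. v k \<odot>\<^bsub>M\<^esub> h (?e k))"
      using insert v h.hom_closed[OF e] by (intro M.M.finsum_cong') auto
    also have "v j \<odot>\<^bsub>M\<^esub> h (?e j) \<oplus>\<^bsub>M\<^esub> \<dots> = (\<Oplus>\<^bsub>M\<^esub>k\<in>insert j J. v k \<odot>\<^bsub>M\<^esub> h (?e k))"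
      using insert v h.hom_closed[OF e] by (subst M.M.finsum_insert) auto
    finally show ?case .
  }
qed

text \<open>With \<open>M\<close> a retract of a free module through \<open>f\<close> and
  \<open>h\<close>, the functionals are the coordinates of \<open>f\<close> and the vectors are the
  images under \<open>h\<close> of the standard basis. Finite generation confines the sum to
  finitely many coordinates.\<close>

lemma finitely_generated_projective_imp_dual_basis:
  fixes M :: "('a, 'b, 'm) module_scheme"
  assumes M: "left_module R M" and fg: "finitely_generated_module R M" and "projective_module R M"
  shows "\<exists>(J :: 'b set) x \<phi>. dual_basis R M J x \<phi>"
proof -
  interpret M: left_module R M by (rule M)
  obtain f h and I :: "'b set"
    where f: "f \<in> left_hom R M (free_module R I)" and h: "h \<in> left_hom R (free_module R I) M"
    and hf: "\<And>a. a \<in> carrier M \<Longrightarrow> h (f a) = a"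
    using assms(3) unfolding projective_module_iff_retraction[OF M] by metis
  interpret F: left_module R "free_module R I" by (rule M.left_module_free_module)
  interpret N: left_module R "restrict_scalars (\<lambda>x. x) R" by (rule M.left_module_regular)
  obtain S where S: "finite S" "S \<subseteq> carrier M"
    and gen: "\<And>a. a \<in> carrier M \<Longrightarrow> \<exists>c\<in>S \<rightarrow> carrier R. a = (\<Oplus>\<^bsub>M\<^esub>s\<in>S. c s \<odot>\<^bsub>M\<^esub> s)"
    using fg by (auto simp: finitely_generated_module_def)
  \<comment> \<open>The coordinates that are nonzero at some generator. There are finitely many,
    since each \<open>f s\<close> has finite support.\<close>
  define J where "J = (\<Union>s\<in>S. {i \<in> I. f s i \<noteq> \<zero>\<^bsub>R\<^esub>})"
  define \<phi> where "\<phi> = (\<lambda>i. \<lambda>a\<in>carrier M. f a i)"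
  note fD = left_homD[OF f]
  have \<phi>: "\<phi> i \<in> left_hom R M (restrict_scalars (\<lambda>x. x) R)" if "i \<in> I" for i
    using that fD(1) by (intro left_homI) (auto simp: \<phi>_def fD(3,4))
  have J: "finite J" "J \<subseteq> I" using S fD(1) by (auto simp: J_def)
  \<comment> \<open>Coordinate \<open>i\<close> is linear and vanishes at every generator, hence on
    all of \<open>M\<close>.\<close>
  have supp: "f a i = \<zero>\<^bsub>R\<^esub>" if a: "a \<in> carrier M" and i: "i \<in> I - J" for a i
  proof -
    obtain c where c: "c \<in> S \<rightarrow> carrier R" "a = (\<Oplus>\<^bsub>M\<^esub>s\<in>S. c s \<odot>\<^bsub>M\<^esub> s)" using gen[OF a] by blast
    have "f a i = \<phi> i (\<Oplus>\<^bsub>M\<^esub>s\<in>S. c s \<odot>\<^bsub>M\<^esub> s)" using a c by (simp add: \<phi>_def)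
    also have "\<dots> = (\<Oplus>\<^bsub>R\<^esub>s\<in>S. c s \<otimes>\<^bsub>R\<^esub> \<phi> i s)"
      using left_hom_finsum_smult[OF \<phi> M N.left_module_axioms, of i S c "\<lambda>s. s"] i c S by auto
    also have "\<dots> = (\<Oplus>\<^bsub>R\<^esub>s\<in>S. \<zero>\<^bsub>R\<^esub>)"
      using c S i by (intro M.R.finsum_cong') (auto simp: \<phi>_def J_def Pi_def)
    finally show ?thesis by simp
  qed
  let ?e = "\<lambda>j. \<lambda>i\<in>I. if i = j then \<one>\<^bsub>R\<^esub> else \<zero>\<^bsub>R\<^esub>"
  have e: "?e j \<in> carrier (free_module R I)" for j
    by (auto intro!: finite_subset[of _ "{j}"] split: if_splits)
  \<comment> \<open>Expand \<open>f a\<close> in the standard basis, apply \<open>h\<close>, and use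
    \<open>h (f a) = a\<close>.\<close>
  have "(\<Oplus>\<^bsub>M\<^esub>j\<in>J. \<phi> j a \<odot>\<^bsub>M\<^esub> h (?e j)) = a" if a: "a \<in> carrier M" for a
    using left_hom_free_module_finite_support[OF M h fD(1)[OF a] J supp[OF a]] a
    by (simp add: \<phi>_def hf)
  then have "dual_basis R M J (\<lambda>j. h (?e j)) \<phi>"
    using J \<phi> left_homD(1)[OF h e] by (auto simp: dual_basis_def)
  then show ?thesis by blast
qed

text \<open>
  The free module in \<^const>\<open>projective_module\<close> is indexed by elements of the module, whereas the
  index type of a dual basis is arbitrary; grouping the coordinates by the values of \<open>x\<close> passes
  from the latter to the former.
\<close>

lemma dual_basis_merge:
  assumes M: "left_module R M" and db: "dual_basis R M I x \<phi>"
  shows "dual_basis R M (x ` I) (\<lambda>s. s) (\<lambda>s. \<lambda>a\<in>carrier M. \<Oplus>\<^bsub>R\<^esub>i\<in>{i \<in> I. x i = s}. \<phi> i a)"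
proof -
  interpret M: left_module R M by (rule M)
  have I: "finite I" and x: "\<And>i. i \<in> I \<Longrightarrow> x i \<in> carrier M"
    and \<phi>: "\<And>i. i \<in> I \<Longrightarrow> \<phi> i \<in> left_hom R M (restrict_scalars (\<lambda>x. x) R)"
    and sum: "\<And>a. a \<in> carrier M \<Longrightarrow> (\<Oplus>\<^bsub>M\<^esub>i\<in>I. \<phi> i a \<odot>\<^bsub>M\<^esub> x i) = a"
    using db by (auto simp: dual_basis_def)
  have \<phi>c: "\<phi> i a \<in> carrier R" if "i \<in> I" "a \<in> carrier M" for i a
    using left_homD(1)[OF \<phi>] that by auto
  have "(\<lambda>a\<in>carrier M. \<Oplus>\<^bsub>R\<^esub>i\<in>{i \<in> I. x i = s}. \<phi> i a) \<in> left_hom R M (restrict_scalars (\<lambda>x. x) R)" for s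
  proof (rule left_homI)
    fix a b assume "a \<in> carrier M" "b \<in> carrier M"
    then show "(\<lambda>a\<in>carrier M. \<Oplus>\<^bsub>R\<^esub>i\<in>{i \<in> I. x i = s}. \<phi> i a) (a \<oplus>\<^bsub>M\<^esub> b) =
      (\<lambda>a\<in>carrier M. \<Oplus>\<^bsub>R\<^esub>i\<in>{i \<in> I. x i = s}. \<phi> i a) a \<oplus>\<^bsub>restrict_scalars (\<lambda>x. x) R\<^esub>
      (\<lambda>a\<in>carrier M. \<Oplus>\<^bsub>R\<^esub>i\<in>{i \<in> I. x i = s}. \<phi> i a) b"
      using M.R.finsum_addf[of "\<lambda>i. \<phi> i a" "{i \<in> I. x i = s}" "\<lambda>i. \<phi> i b"] \<phi>c
        M.R.finsum_cong'[of "{i \<in> I. x i = s}" _ "\<lambda>i. \<phi> i a \<oplus>\<^bsub>R\<^esub> \<phi> i b" "\<lambda>i. \<phi> i (a \<oplus>\<^bsub>M\<^esub> b)"]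
        left_homD(3)[OF \<phi>]
      by auto
  next
    fix r a assume "r \<in> carrier R" "a \<in> carrier M"
    then show "(\<lambda>a\<in>carrier M. \<Oplus>\<^bsub>R\<^esub>i\<in>{i \<in> I. x i = s}. \<phi> i a) (r \<odot>\<^bsub>M\<^esub> a) =
      r \<odot>\<^bsub>restrict_scalars (\<lambda>x. x) R\<^esub> (\<lambda>a\<in>carrier M. \<Oplus>\<^bsub>R\<^esub>i\<in>{i \<in> I. x i = s}. \<phi> i a) a"
      using \<phi>c left_homD(4)[OF \<phi>] I
      by (auto simp: M.finsum_rdistr intro!: M.R.finsum_cong')
  qed (auto intro!: M.R.finsum_closed \<phi>c)
  moreover have "(\<Oplus>\<^bsub>M\<^esub>s\<in>x ` I. (\<Oplus>\<^bsub>R\<^esub>i\<in>{i \<in> I. x i = s}. \<phi> i a) \<odot>\<^bsub>M\<^esub> s) = a" if a: "a \<in> carrier M" for a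
  proof -
    have "(\<Oplus>\<^bsub>R\<^esub>i\<in>{i \<in> I. x i = s}. \<phi> i a) \<odot>\<^bsub>M\<^esub> s = (\<Oplus>\<^bsub>M\<^esub>i\<in>{i \<in> I. x i = s}. \<phi> i a \<odot>\<^bsub>M\<^esub> x i)"
      if "s \<in> x ` I" for s
    proof -
      \<comment> \<open>The action is additive in the scalar, and on this fibre every
        \<open>x i\<close> equals \<open>s\<close>.\<close>
      have "(\<Oplus>\<^bsub>R\<^esub>i\<in>{i \<in> I. x i = s}. \<phi> i a) \<odot>\<^bsub>M\<^esub> s = (\<Oplus>\<^bsub>M\<^esub>i\<in>{i \<in> I. x i = s}. \<phi> i a \<odot>\<^bsub>M\<^esub> s)"
        using that x \<phi>c a by (intro abelian_group_hom.hom_finsum[OF M.abelian_group_hom_smult_left]) auto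
      also have "\<dots> = (\<Oplus>\<^bsub>M\<^esub>i\<in>{i \<in> I. x i = s}. \<phi> i a \<odot>\<^bsub>M\<^esub> x i)"
        using x \<phi>c a by (intro M.M.finsum_cong') auto
      finally show ?thesis .
    qed
    then have "(\<Oplus>\<^bsub>M\<^esub>s\<in>x ` I. (\<Oplus>\<^bsub>R\<^esub>i\<in>{i \<in> I. x i = s}. \<phi> i a) \<odot>\<^bsub>M\<^esub> s) =
        (\<Oplus>\<^bsub>M\<^esub>s\<in>x ` I. \<Oplus>\<^bsub>M\<^esub>i\<in>{i \<in> I. x i = s}. \<phi> i a \<odot>\<^bsub>M\<^esub> x i)"
      using x \<phi>c a by (intro M.M.finsum_cong') (auto intro!: M.M.finsum_closed)
    also have "\<dots> = a"
      using x \<phi>c a I sum by (simp add: M.M.finsum_fibres)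
    finally show ?thesis .
  qed
  ultimately show ?thesis
    using I x by (auto simp: dual_basis_def)
qed

text \<open>After merging, the vectors index themselves. Then \<open>f\<close> lists the values of
  the functionals, \<open>h\<close> forms linear combinations of the vectors, and
  \<open>h (f a) = a\<close> is the dual basis identity.\<close>

lemma dual_basis_imp_finitely_generated_projective:
  fixes M :: "('a, 'b, 'm) module_scheme"
  assumes M: "left_module R M" and "dual_basis R M I x \<phi>"
  shows "finitely_generated_module R M" "projective_module R M"
proof -
  interpret M: left_module R M by (rule M)
  obtain S and \<psi> :: "'b \<Rightarrow> 'b \<Rightarrow> 'a" where "dual_basis R M S (\<lambda>s. s) \<psi>"
    using dual_basis_merge[OF assms] by blast
  then have S: "finite S" "S \<subseteq> carrier M"
    and \<psi>: "\<And>i. i \<in> S \<Longrightarrow> \<psi> i \<in> left_hom R M (restrict_scalars (\<lambda>x. x) R)"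
    and sum: "\<And>a. a \<in> carrier M \<Longrightarrow> (\<Oplus>\<^bsub>M\<^esub>s\<in>S. \<psi> s a \<odot>\<^bsub>M\<^esub> s) = a"
    by (auto simp: dual_basis_def)
  have \<psi>c: "\<psi> s a \<in> carrier R" if "s \<in> S" "a \<in> carrier M" for s a
    using left_homD(1)[OF \<psi>] that by auto
  show "finitely_generated_module R M"
    unfolding finitely_generated_module_def
  proof (intro exI[of _ S] conjI ballI)
    fix a assume "a \<in> carrier M"
    then show "\<exists>c\<in>S \<rightarrow> carrier R. a = (\<Oplus>\<^bsub>M\<^esub>s\<in>S. c s \<odot>\<^bsub>M\<^esub> s)"
      using \<psi>c sum by (intro bexI[of _ "\<lambda>s. \<psi> s a"]) auto
  qed (use S in auto)
  define f where "f = (\<lambda>a\<in>carrier M. \<lambda>s\<in>S. \<psi> s a)"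
  define h where "h = (\<lambda>v\<in>carrier (free_module R S). \<Oplus>\<^bsub>M\<^esub>s\<in>S. v s \<odot>\<^bsub>M\<^esub> s)"
  have F: "left_module R (free_module R S)" by (rule M.left_module_free_module)
  have fc: "f a \<in> carrier (free_module R S)" if "a \<in> carrier M" for a
    using that S \<psi>c by (auto simp: f_def)
  have f: "f \<in> left_hom R M (free_module R S)"
    using fc left_homD(3,4)[OF \<psi>]
    by (intro left_homI) (auto simp: f_def fun_eq_iff)
  interpret F: left_module R "free_module R S" by (rule F)
  have h: "h \<in> left_hom R (free_module R S) M"
  proof (rule left_homI)
    show "h \<in> carrier (free_module R S) \<rightarrow>\<^sub>E carrier M"
      using S by (auto simp: h_def intro!: M.M.finsum_closed)
  next
    fix v w assume vw: "v \<in> carrier (free_module R S)" "w \<in> carrier (free_module R S)"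
    then have c: "\<And>s. s \<in> S \<Longrightarrow> v s \<in> carrier R" "\<And>s. s \<in> S \<Longrightarrow> w s \<in> carrier R" by auto
    have "h (v \<oplus>\<^bsub>free_module R S\<^esub> w) = (\<Oplus>\<^bsub>M\<^esub>s\<in>S. (v \<oplus>\<^bsub>free_module R S\<^esub> w) s \<odot>\<^bsub>M\<^esub> s)"
      unfolding h_def using F.M.add.m_closed[OF vw] by (simp del: free_module_simps)
    also have "\<dots> = (\<Oplus>\<^bsub>M\<^esub>s\<in>S. v s \<odot>\<^bsub>M\<^esub> s \<oplus>\<^bsub>M\<^esub> w s \<odot>\<^bsub>M\<^esub> s)"
      using c S by (intro M.M.finsum_cong') (auto simp: M.smult_l_distr)
    also have "\<dots> = h v \<oplus>\<^bsub>M\<^esub> h w"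
      unfolding h_def using vw c S by (subst M.M.finsum_addf) auto
    finally show "h (v \<oplus>\<^bsub>free_module R S\<^esub> w) = h v \<oplus>\<^bsub>M\<^esub> h w" .
  next
    fix r v assume r: "r \<in> carrier R" and v: "v \<in> carrier (free_module R S)"
    then have c: "\<And>s. s \<in> S \<Longrightarrow> v s \<in> carrier R" by auto
    have "h (r \<odot>\<^bsub>free_module R S\<^esub> v) = (\<Oplus>\<^bsub>M\<^esub>s\<in>S. (r \<odot>\<^bsub>free_module R S\<^esub> v) s \<odot>\<^bsub>M\<^esub> s)"
      unfolding h_def using F.smult_closed[OF r v] by (simp del: free_module_simps)
    also have "\<dots> = (\<Oplus>\<^bsub>M\<^esub>s\<in>S. r \<odot>\<^bsub>M\<^esub> (v s \<odot>\<^bsub>M\<^esub> s))"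
      using c S r by (intro M.M.finsum_cong') (auto simp: M.smult_assoc)
    also have "\<dots> = r \<odot>\<^bsub>M\<^esub> h v"
      unfolding h_def using v c S r
      by (simp add: abelian_group_hom.hom_finsum[OF M.abelian_group_hom_smult[OF r]] subset_iff
          del: free_module_simps)
    finally show "h (r \<odot>\<^bsub>free_module R S\<^esub> v) = r \<odot>\<^bsub>M\<^esub> h v" .
  qed
  have "h (f a) = a" if a: "a \<in> carrier M" for a
  proof -
    have "h (f a) = (\<Oplus>\<^bsub>M\<^esub>s\<in>S. \<psi> s a \<odot>\<^bsub>M\<^esub> s)"
      unfolding h_def using fc[OF a] S a \<psi>c
      by (auto simp: f_def simp del: free_module_simps intro!: M.M.finsum_cong')
    then show ?thesis by (simp add: sum[OF a])
  qed
  then show "projective_module R M"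
    using f h by (auto simp only: projective_module_iff_retraction[OF M])
qed

section \<open>Frobenius systems\<close>

text \<open>The index type is independent of \<open>A\<close>, so that the matrix rings can be
  indexed by pairs. \<open>E\<close> need not be extensional, so that \<open>map_mat E\<close>
  qualifies as it stands.\<close>

locale frobenius_system = ring_hom_ring R A \<iota>
  for R :: "('r, 'q) ring_scheme" (structure) and A :: "('a, 'p) ring_scheme" (structure) and \<iota> +
  fixes I :: "'i set" and E :: "'a \<Rightarrow> 'r" and x y :: "'i \<Rightarrow> 'a"
  assumes finite_index: "finite I"
    and x_closed: "\<And>i. i \<in> I \<Longrightarrow> x i \<in> carrier A"
    and y_closed: "\<And>i. i \<in> I \<Longrightarrow> y i \<in> carrier A"
    and E_closed: "\<And>a. a \<in> carrier A \<Longrightarrow> E a \<in> carrier R"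
    and E_add: "\<And>a b. a \<in> carrier A \<Longrightarrow> b \<in> carrier A \<Longrightarrow> E (a \<oplus>\<^bsub>A\<^esub> b) = E a \<oplus>\<^bsub>R\<^esub> E b"
    and E_left: "\<And>r a. r \<in> carrier R \<Longrightarrow> a \<in> carrier A \<Longrightarrow> E (\<iota> r \<otimes>\<^bsub>A\<^esub> a) = r \<otimes>\<^bsub>R\<^esub> E a"
    and E_right: "\<And>r a. r \<in> carrier R \<Longrightarrow> a \<in> carrier A \<Longrightarrow> E (a \<otimes>\<^bsub>A\<^esub> \<iota> r) = E a \<otimes>\<^bsub>R\<^esub> r"
    and expand_left: "\<And>a. a \<in> carrier A \<Longrightarrow> (\<Oplus>\<^bsub>A\<^esub>i\<in>I. \<iota> (E (a \<otimes>\<^bsub>A\<^esub> y i)) \<otimes>\<^bsub>A\<^esub> x i) = a"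
    and expand_right: "\<And>a. a \<in> carrier A \<Longrightarrow> (\<Oplus>\<^bsub>A\<^esub>i\<in>I. y i \<otimes>\<^bsub>A\<^esub> \<iota> (E (x i \<otimes>\<^bsub>A\<^esub> a))) = a"

lemma extension_bimodule_simps [simp]:
  "carrier (extension_bimodule A \<iota>) = carrier A"
  "add (extension_bimodule A \<iota>) = add A"
  "smult (extension_bimodule A \<iota>) = monoid.mult A"
  "rsmult (extension_bimodule A \<iota>) = (\<lambda>a r. a \<otimes>\<^bsub>A\<^esub> \<iota> r)"
  by (simp_all add: extension_bimodule_def)

lemma dual_bimodule_simps [simp]:
  "carrier (dual_bimodule R A \<iota>) = left_hom R (restrict_scalars \<iota> A) (restrict_scalars (\<lambda>x. x) R)"
  "add (dual_bimodule R A \<iota>) = (\<lambda>f g. \<lambda>x\<in>carrier A. f x \<oplus>\<^bsub>R\<^esub> g x)"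
  "smult (dual_bimodule R A \<iota>) = (\<lambda>a f. \<lambda>x\<in>carrier A. f (x \<otimes>\<^bsub>A\<^esub> a))"
  "rsmult (dual_bimodule R A \<iota>) = (\<lambda>f r. \<lambda>x\<in>carrier A. f x \<otimes>\<^bsub>R\<^esub> r)"
  by (simp_all add: dual_bimodule_def)

lemma (in ring_hom_ring) left_hom_finsum_restrict_scalars:
  assumes f: "f \<in> left_hom R (restrict_scalars h S) (restrict_scalars (\<lambda>x. x) R)"
    and "\<And>i. i \<in> I \<Longrightarrow> c i \<in> carrier R" "\<And>i. i \<in> I \<Longrightarrow> x i \<in> carrier S"
  shows "f (\<Oplus>\<^bsub>S\<^esub>i\<in>I. h (c i) \<otimes>\<^bsub>S\<^esub> x i) = (\<Oplus>\<^bsub>R\<^esub>i\<in>I. c i \<otimes>\<^bsub>R\<^esub> f (x i))"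
  using left_hom_finsum_smult[OF f left_module_restrict_scalars R.left_module_regular, of I c x]
    assms(2,3)
  by simp

lemma (in ring_hom_ring) left_hom_finsum:
  assumes f: "f \<in> left_hom R (restrict_scalars h S) (restrict_scalars (\<lambda>x. x) R)"
    and "\<And>i. i \<in> I \<Longrightarrow> a i \<in> carrier S"
  shows "f (\<Oplus>\<^bsub>S\<^esub>i\<in>I. a i) = (\<Oplus>\<^bsub>R\<^esub>i\<in>I. f (a i))"
  using abelian_group_hom.hom_finsum[OF left_hom_abelian_group_hom[OF f
      left_module_restrict_scalars R.left_module_regular], of I a] assms(2) by simp

text \<open>The left expansion is the dual basis identity rewritten through \<Phi>. The right
  expansion is deduced from the left one by injectivity of \<Phi>.\<close>

lemma frobenius_extension_imp_frobenius_system: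
  fixes A :: "('a, 'p) ring_scheme"
  assumes "frobenius_extension R A \<iota>"
  shows "\<exists>(I :: 'a set) E x y. frobenius_system R A \<iota> I E x y"
proof -
  have hom: "ring_hom_ring R A \<iota>"
    and fg: "finitely_generated_module R (restrict_scalars \<iota> A)"
    and pr: "projective_module R (restrict_scalars \<iota> A)"
    using assms by (auto simp: frobenius_extension_def)
  interpret ring_hom_ring R A \<iota> by (rule hom)
  let ?D = "left_hom R (restrict_scalars \<iota> A) (restrict_scalars (\<lambda>x. x) R)"
  obtain \<Phi> where \<Phi>: "\<Phi> \<in> bimodule_iso A R (extension_bimodule A \<iota>) (dual_bimodule R A \<iota>)"
    using assms by (auto simp: frobenius_extension_def)
  have bij: "bij_betw \<Phi> (carrier A) ?D"
    and \<Phi>_left: "\<And>a b. a \<in> carrier A \<Longrightarrow> b \<in> carrier A \<Longrightarrow> \<Phi> (a \<otimes>\<^bsub>A\<^esub> b) = (\<lambda>x\<in>carrier A. \<Phi> b (x \<otimes>\<^bsub>A\<^esub> a))"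
    and \<Phi>_right: "\<And>a r. a \<in> carrier A \<Longrightarrow> r \<in> carrier R \<Longrightarrow> \<Phi> (a \<otimes>\<^bsub>A\<^esub> \<iota> r) = (\<lambda>x\<in>carrier A. \<Phi> a x \<otimes>\<^bsub>R\<^esub> r)"
    using \<Phi> by (auto simp: bimodule_iso_def left_hom_def)
  define E where "E = \<Phi> \<one>\<^bsub>A\<^esub>"
  have ED: "E \<in> ?D" using bij by (auto simp: E_def bij_betw_def)
  note E = left_homD[OF ED, simplified]
  \<comment> \<open>Left \<open>A\<close>-linearity at the product of \<open>a\<close> and one shows
    that \<Phi> is determined by \<open>E\<close>.\<close>
  have \<Phi>_eq: "\<Phi> a = (\<lambda>x\<in>carrier A. E (x \<otimes>\<^bsub>A\<^esub> a))" if "a \<in> carrier A" for a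
    using \<Phi>_left[OF that S.one_closed] that by (simp add: E_def)
  have E_right: "E (a \<otimes>\<^bsub>A\<^esub> \<iota> r) = E a \<otimes>\<^bsub>R\<^esub> r" if "r \<in> carrier R" "a \<in> carrier A" for a r
  proof -
    \<comment> \<open>\<open>\<Phi> (\<iota> r)\<close> is computed twice: here by right
      \<open>R\<close>-linearity at one, then by \<open>\<Phi>_eq\<close>. Comparing the values at
      \<open>a\<close> gives the claim.\<close>
    have "\<Phi> (\<iota> r) = (\<lambda>x\<in>carrier A. E x \<otimes>\<^bsub>R\<^esub> r)"
      using \<Phi>_right[of "\<one>\<^bsub>A\<^esub>" r] that by (simp add: E_def)
    then show ?thesis using \<Phi>_eq[of "\<iota> r"] that by (metis hom_closed restrict_apply')
  qed
  obtain I :: "'a set" and x \<phi> where db: "dual_basis R (restrict_scalars \<iota> A) I x \<phi>"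
    using finitely_generated_projective_imp_dual_basis[OF left_module_restrict_scalars fg pr] by blast
  then have I: "finite I" and x: "\<And>i. i \<in> I \<Longrightarrow> x i \<in> carrier A"
    and \<phi>: "\<And>i. i \<in> I \<Longrightarrow> \<phi> i \<in> ?D"
    and sum: "\<And>a. a \<in> carrier A \<Longrightarrow> (\<Oplus>\<^bsub>A\<^esub>i\<in>I. \<iota> (\<phi> i a) \<otimes>\<^bsub>A\<^esub> x i) = a"
    by (auto simp: dual_basis_def)
  \<comment> \<open>Surjectivity of \<Phi> represents each functional \<open>\<phi> i\<close> by an
    element of \<open>A\<close>.\<close>
  define y where "y = (\<lambda>i. inv_into (carrier A) \<Phi> (\<phi> i))"
  have y: "y i \<in> carrier A" "\<Phi> (y i) = \<phi> i" if "i \<in> I" for i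
    using \<phi>[OF that] bij unfolding y_def bij_betw_def
    by (metis inv_into_into, metis f_inv_into_f)
  have \<phi>_eq: "\<phi> i a = E (a \<otimes>\<^bsub>A\<^esub> y i)" if "i \<in> I" "a \<in> carrier A" for i a
    using \<Phi>_eq[of "y i"] y[OF that(1)] that by simp
  have expand_left: "(\<Oplus>\<^bsub>A\<^esub>i\<in>I. \<iota> (E (a \<otimes>\<^bsub>A\<^esub> y i)) \<otimes>\<^bsub>A\<^esub> x i) = a" if a: "a \<in> carrier A" for a
  proof -
    have "(\<Oplus>\<^bsub>A\<^esub>i\<in>I. \<iota> (E (a \<otimes>\<^bsub>A\<^esub> y i)) \<otimes>\<^bsub>A\<^esub> x i) = (\<Oplus>\<^bsub>A\<^esub>i\<in>I. \<iota> (\<phi> i a) \<otimes>\<^bsub>A\<^esub> x i)"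
      using a x y E(1) by (intro S.finsum_cong') (auto simp: \<phi>_eq)
    with sum[OF a] show ?thesis by simp
  qed
  have expand_right: "(\<Oplus>\<^bsub>A\<^esub>i\<in>I. y i \<otimes>\<^bsub>A\<^esub> \<iota> (E (x i \<otimes>\<^bsub>A\<^esub> a))) = a" if a: "a \<in> carrier A" for a
  proof -
    let ?a = "\<Oplus>\<^bsub>A\<^esub>i\<in>I. y i \<otimes>\<^bsub>A\<^esub> \<iota> (E (x i \<otimes>\<^bsub>A\<^esub> a))"
    have ca: "?a \<in> carrier A" using a x y E(1) by (auto intro!: S.finsum_closed)
    \<comment> \<open>By \<open>\<Phi>_eq\<close> this says that \<open>?a\<close> and
      \<open>a\<close> have the same image under \<Phi>.\<close>
    have "E (b \<otimes>\<^bsub>A\<^esub> ?a) = E (b \<otimes>\<^bsub>A\<^esub> a)" if b: "b \<in> carrier A" for b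
    proof -
      have "b \<otimes>\<^bsub>A\<^esub> ?a = (\<Oplus>\<^bsub>A\<^esub>i\<in>I. b \<otimes>\<^bsub>A\<^esub> (y i \<otimes>\<^bsub>A\<^esub> \<iota> (E (x i \<otimes>\<^bsub>A\<^esub> a))))"
        using a b x y E(1) I by (intro S.finsum_rdistr) auto
      also have "E \<dots> = (\<Oplus>\<^bsub>R\<^esub>i\<in>I. E (b \<otimes>\<^bsub>A\<^esub> (y i \<otimes>\<^bsub>A\<^esub> \<iota> (E (x i \<otimes>\<^bsub>A\<^esub> a)))))"
        using a b x y E(1) by (intro left_hom_finsum[OF ED]) auto
      \<comment> \<open>Right linearity pulls \<open>E (x i a)\<close> out of \<open>E\<close>. Left
        linearity then moves \<open>E (b y i)\<close> back inside, where the left expansion of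
        \<open>b\<close> absorbs the sum.\<close>
      also have "\<dots> = (\<Oplus>\<^bsub>R\<^esub>i\<in>I. E (b \<otimes>\<^bsub>A\<^esub> y i) \<otimes>\<^bsub>R\<^esub> E (x i \<otimes>\<^bsub>A\<^esub> a))"
        using a b x y E(1) by (intro R.finsum_cong') (auto simp: E_right simp flip: S.m_assoc)
      also have "\<dots> = E (\<Oplus>\<^bsub>A\<^esub>i\<in>I. \<iota> (E (b \<otimes>\<^bsub>A\<^esub> y i)) \<otimes>\<^bsub>A\<^esub> (x i \<otimes>\<^bsub>A\<^esub> a))"
        using a b x y E(1) by (intro left_hom_finsum_restrict_scalars[OF ED, symmetric]) auto
      also have "(\<Oplus>\<^bsub>A\<^esub>i\<in>I. \<iota> (E (b \<otimes>\<^bsub>A\<^esub> y i)) \<otimes>\<^bsub>A\<^esub> (x i \<otimes>\<^bsub>A\<^esub> a)) =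
          (\<Oplus>\<^bsub>A\<^esub>i\<in>I. \<iota> (E (b \<otimes>\<^bsub>A\<^esub> y i)) \<otimes>\<^bsub>A\<^esub> x i \<otimes>\<^bsub>A\<^esub> a)"
        using a b x y E(1) by (intro S.finsum_cong') (auto simp: S.m_assoc)
      also have "\<dots> = (\<Oplus>\<^bsub>A\<^esub>i\<in>I. \<iota> (E (b \<otimes>\<^bsub>A\<^esub> y i)) \<otimes>\<^bsub>A\<^esub> x i) \<otimes>\<^bsub>A\<^esub> a"
        using a b x y E(1) I by (intro S.finsum_ldistr[symmetric]) auto
      finally show ?thesis using expand_left[OF b] by simp
    qed
    then have "\<Phi> ?a = \<Phi> a" using \<Phi>_eq[OF ca] \<Phi>_eq[OF a] by (simp add: fun_eq_iff)
    then show ?thesis using bij ca a by (simp add: bij_betw_def inj_on_def)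
  qed
  have "frobenius_system R A \<iota> I E x y"
    using I x y(1) E E_right expand_left expand_right by unfold_locales auto
  then show ?thesis by blast
qed

text \<open>The left expansion makes the functionals \<open>\<Phi> (y i)\<close> and the vectors
  \<open>x i\<close> a dual basis. The right expansion recovers \<open>a\<close> from the values
  \<open>E (x i a)\<close> of \<open>\<Phi> a\<close>, which gives injectivity and also suggests the
  preimages for surjectivity.\<close>

lemma (in frobenius_system) frobenius_extension: "frobenius_extension R A \<iota>"
proof -
  let ?D = "left_hom R (restrict_scalars \<iota> A) (restrict_scalars (\<lambda>x. x) R)"
  define \<Phi> where "\<Phi> = (\<lambda>a\<in>carrier A. \<lambda>x\<in>carrier A. E (x \<otimes>\<^bsub>A\<^esub> a))"
  have \<Phi>c: "\<Phi> a \<in> ?D" if "a \<in> carrier A" for a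
    using that by (intro left_homI) (auto simp: \<Phi>_def E_closed E_add E_left S.l_distr S.m_assoc)
  have M: "left_module R (restrict_scalars \<iota> A)" by (rule left_module_restrict_scalars)
  have "dual_basis R (restrict_scalars \<iota> A) I x (\<lambda>i. \<Phi> (y i))"
    using finite_index \<Phi>c by (auto simp: dual_basis_def x_closed y_closed \<Phi>_def expand_left
        E_closed cong: S.finsum_cong)
  note fgp = dual_basis_imp_finitely_generated_projective[OF M this]
  have inj: "inj_on \<Phi> (carrier A)"
  proof (rule inj_onI)
    fix a b assume ab: "a \<in> carrier A" "b \<in> carrier A" "\<Phi> a = \<Phi> b"
    have "E (x i \<otimes>\<^bsub>A\<^esub> a) = E (x i \<otimes>\<^bsub>A\<^esub> b)" if "i \<in> I" for i
      using fun_cong[OF ab(3), of "x i"] ab x_closed[OF that] by (simp add: \<Phi>_def)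
    then have "(\<Oplus>\<^bsub>A\<^esub>i\<in>I. y i \<otimes>\<^bsub>A\<^esub> \<iota> (E (x i \<otimes>\<^bsub>A\<^esub> a))) = (\<Oplus>\<^bsub>A\<^esub>i\<in>I. y i \<otimes>\<^bsub>A\<^esub> \<iota> (E (x i \<otimes>\<^bsub>A\<^esub> b)))"
      using ab by (intro S.finsum_cong') (auto simp: x_closed y_closed E_closed)
    then show "a = b" using expand_right ab by simp
  qed
  have surj: "f \<in> \<Phi> ` carrier A" if f: "f \<in> ?D" for f
  proof -
    note fD = left_homD[OF f, simplified]
    \<comment> \<open>If \<open>f = \<Phi> a\<close>, then \<open>f (x i) = E (x i a)\<close>, so
      the right expansion leaves only this candidate.\<close>
    define a where "a = (\<Oplus>\<^bsub>A\<^esub>i\<in>I. y i \<otimes>\<^bsub>A\<^esub> \<iota> (f (x i)))"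
    have a: "a \<in> carrier A" unfolding a_def by (auto intro!: S.finsum_closed simp: x_closed y_closed fD)
    \<comment> \<open>Members of \<open>left_hom\<close> are extensional, whereas \<open>E\<close>
      may take any value outside the carrier.\<close>
    have ED: "restrict E (carrier A) \<in> ?D"
      by (intro left_homI) (auto simp: E_closed E_add E_left)
    have "E (b \<otimes>\<^bsub>A\<^esub> a) = f b" if b: "b \<in> carrier A" for b
    proof -
      have "b \<otimes>\<^bsub>A\<^esub> a = (\<Oplus>\<^bsub>A\<^esub>i\<in>I. b \<otimes>\<^bsub>A\<^esub> (y i \<otimes>\<^bsub>A\<^esub> \<iota> (f (x i))))"
        unfolding a_def using b finite_index
        by (intro S.finsum_rdistr) (auto simp: x_closed y_closed fD)
      also have "restrict E (carrier A) \<dots> =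
          (\<Oplus>\<^bsub>R\<^esub>i\<in>I. restrict E (carrier A) (b \<otimes>\<^bsub>A\<^esub> (y i \<otimes>\<^bsub>A\<^esub> \<iota> (f (x i)))))"
        using b by (intro left_hom_finsum[OF ED]) (auto simp: x_closed y_closed fD)
      also have "\<dots> = (\<Oplus>\<^bsub>R\<^esub>i\<in>I. E (b \<otimes>\<^bsub>A\<^esub> y i) \<otimes>\<^bsub>R\<^esub> f (x i))"
        using b by (intro R.finsum_cong')
          (auto simp: x_closed y_closed fD E_right E_closed simp flip: S.m_assoc)
      \<comment> \<open>Left linearity of \<open>f\<close> gathers the sum inside \<open>f\<close>,
        where it is the left expansion of \<open>b\<close>.\<close>
      also have "\<dots> = f (\<Oplus>\<^bsub>A\<^esub>i\<in>I. \<iota> (E (b \<otimes>\<^bsub>A\<^esub> y i)) \<otimes>\<^bsub>A\<^esub> x i)"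
        using b by (intro left_hom_finsum_restrict_scalars[OF f, symmetric])
          (auto simp: x_closed y_closed E_closed)
      finally show ?thesis using expand_left[OF b] a b by simp
    qed
    then have "f = \<Phi> a"
      using a fD(2) by (auto simp: \<Phi>_def fun_eq_iff extensional_def)
    with a show ?thesis by blast
  qed
  have "\<Phi> \<in> left_hom A (extension_bimodule A \<iota>) (dual_bimodule R A \<iota>)"
    using \<Phi>c
    by (intro left_homI)
      (auto simp: \<Phi>_def fun_eq_iff E_add S.r_distr S.m_assoc)
  moreover have "\<Phi> (a \<otimes>\<^bsub>A\<^esub> \<iota> r) = (\<lambda>x\<in>carrier A. \<Phi> a x \<otimes>\<^bsub>R\<^esub> r)" if "a \<in> carrier A" "r \<in> carrier R" for a r
    using that by (auto simp: \<Phi>_def fun_eq_iff E_right simp flip: S.m_assoc)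
  moreover have "bij_betw \<Phi> (carrier A) ?D"
    using inj surj \<Phi>c by (auto simp: bij_betw_def)
  ultimately have "\<Phi> \<in> bimodule_iso A R (extension_bimodule A \<iota>) (dual_bimodule R A \<iota>)"
    by (auto simp: bimodule_iso_def)
  then show ?thesis
    using fgp ring_hom_ring_axioms by (auto simp: frobenius_extension_def)
qed

section \<open>Matrix rings\<close>

lemma carrier_matrix_ring:
  "X \<in> carrier (matrix_ring m R) \<longleftrightarrow>
    X \<in> carrier_mat m m \<and> (\<forall>i<m. \<forall>j<m. X $$ (i, j) \<in> carrier R)"
  by (auto simp: matrix_ring_def)

lemma matrix_ring_simps [simp]:
  "X \<oplus>\<^bsub>matrix_ring m R\<^esub> Y = mat m m (\<lambda>(i, j). X $$ (i, j) \<oplus>\<^bsub>R\<^esub> Y $$ (i, j))"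
  "X \<otimes>\<^bsub>matrix_ring m R\<^esub> Y = mat m m (\<lambda>(i, j). \<Oplus>\<^bsub>R\<^esub>k\<in>{..<m}. X $$ (i, k) \<otimes>\<^bsub>R\<^esub> Y $$ (k, j))"
  "\<zero>\<^bsub>matrix_ring m R\<^esub> = mat m m (\<lambda>(i, j). \<zero>\<^bsub>R\<^esub>)"
  "\<one>\<^bsub>matrix_ring m R\<^esub> = mat m m (\<lambda>(i, j). if i = j then \<one>\<^bsub>R\<^esub> else \<zero>\<^bsub>R\<^esub>)"
  by (simp_all add: matrix_ring_def)

lemma matrix_ring_eqI:
  assumes "X \<in> carrier (matrix_ring m R)" "Y \<in> carrier (matrix_ring m R)"
    "\<And>i j. i < m \<Longrightarrow> j < m \<Longrightarrow> X $$ (i, j) = Y $$ (i, j)"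
  shows "X = Y"
  using assms by (intro eq_matI) (auto simp: carrier_matrix_ring)

lemma map_mat_carrier_matrix_ring:
  assumes "X \<in> carrier (matrix_ring m R)" "\<And>a. a \<in> carrier R \<Longrightarrow> f a \<in> carrier S"
  shows "map_mat f X \<in> carrier (matrix_ring m S)"
  using assms by (auto simp: carrier_matrix_ring)

context ring
begin

lemma finsum_delta_left:
  assumes "finite I" "j \<in> I" "f j \<in> carrier R"
  shows "(\<Oplus>i\<in>I. if i = j then f i else \<zero>) = f j"
proof -
  \<comment> \<open>Passing to the constant \<open>f j\<close> leaves \<open>f j\<close> as the only
    value that must lie in the carrier.\<close>
  have "(\<Oplus>i\<in>I. if i = j then f i else \<zero>) = (\<Oplus>i\<in>I. if j = i then f j else \<zero>)"
    using assms by (intro finsum_cong') auto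
  with add.finprod_singleton[of j I "\<lambda>_. f j"] assms show ?thesis by simp
qed

lemma ring_matrix_ring: "ring (matrix_ring m R)"
proof (rule ringI)
  show "abelian_group (matrix_ring m R)"
  proof (rule abelian_groupI)
    fix X assume X: "X \<in> carrier (matrix_ring m R)"
    then show "\<exists>Y\<in>carrier (matrix_ring m R). Y \<oplus>\<^bsub>matrix_ring m R\<^esub> X = \<zero>\<^bsub>matrix_ring m R\<^esub>"
      by (intro bexI[of _ "map_mat (\<lambda>a. \<ominus> a) X"])
        (auto simp: carrier_matrix_ring l_neg intro!: eq_matI)
  qed (auto simp: carrier_matrix_ring a_ac intro!: eq_matI)
  show "monoid (matrix_ring m R)"
  proof (rule monoidI)
    fix X Y assume "X \<in> carrier (matrix_ring m R)" "Y \<in> carrier (matrix_ring m R)"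
    then show "X \<otimes>\<^bsub>matrix_ring m R\<^esub> Y \<in> carrier (matrix_ring m R)"
      by (auto simp: carrier_matrix_ring intro!: finsum_closed)
  next
    fix X Y Z assume XYZ: "X \<in> carrier (matrix_ring m R)" "Y \<in> carrier (matrix_ring m R)"
      "Z \<in> carrier (matrix_ring m R)"
    show "X \<otimes>\<^bsub>matrix_ring m R\<^esub> Y \<otimes>\<^bsub>matrix_ring m R\<^esub> Z = X \<otimes>\<^bsub>matrix_ring m R\<^esub> (Y \<otimes>\<^bsub>matrix_ring m R\<^esub> Z)"
    proof (intro eq_matI)
      fix i j assume "i < dim_row (X \<otimes>\<^bsub>matrix_ring m R\<^esub> (Y \<otimes>\<^bsub>matrix_ring m R\<^esub> Z))"
        "j < dim_col (X \<otimes>\<^bsub>matrix_ring m R\<^esub> (Y \<otimes>\<^bsub>matrix_ring m R\<^esub> Z))"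
      then have ij: "i < m" "j < m" by auto
      have X: "X $$ (i, k) \<in> carrier R" if "k < m" for k
        using XYZ that ij by (auto simp: carrier_matrix_ring)
      have Y: "Y $$ (k, l) \<in> carrier R" if "k < m" "l < m" for k l
        using XYZ that by (auto simp: carrier_matrix_ring)
      have Z: "Z $$ (l, j) \<in> carrier R" if "l < m" for l
        using XYZ that ij by (auto simp: carrier_matrix_ring)
      \<comment> \<open>Both bracketings are the same double sum over \<open>k\<close> and
        \<open>l\<close>, taken in opposite orders.\<close>
      have "(X \<otimes>\<^bsub>matrix_ring m R\<^esub> Y \<otimes>\<^bsub>matrix_ring m R\<^esub> Z) $$ (i, j) =
          (\<Oplus>l\<in>{..<m}. (\<Oplus>k\<in>{..<m}. X $$ (i, k) \<otimes> Y $$ (k, l)) \<otimes> Z $$ (l, j))"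
        using ij X Y Z by (auto intro!: finsum_cong' finsum_closed)
      also have "\<dots> = (\<Oplus>l\<in>{..<m}. \<Oplus>k\<in>{..<m}. X $$ (i, k) \<otimes> Y $$ (k, l) \<otimes> Z $$ (l, j))"
        using X Y Z by (intro finsum_cong' finsum_ldistr) (auto intro!: finsum_closed)
      also have "\<dots> = (\<Oplus>k\<in>{..<m}. \<Oplus>l\<in>{..<m}. X $$ (i, k) \<otimes> Y $$ (k, l) \<otimes> Z $$ (l, j))"
        using X Y Z by (intro finsum_swap) auto
      also have "\<dots> = (\<Oplus>k\<in>{..<m}. \<Oplus>l\<in>{..<m}. X $$ (i, k) \<otimes> (Y $$ (k, l) \<otimes> Z $$ (l, j)))"
        using X Y Z by (intro finsum_cong') (auto simp: m_assoc intro!: finsum_closed)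
      also have "\<dots> = (\<Oplus>k\<in>{..<m}. X $$ (i, k) \<otimes> (\<Oplus>l\<in>{..<m}. Y $$ (k, l) \<otimes> Z $$ (l, j)))"
        using X Y Z by (intro finsum_cong' finsum_rdistr[symmetric]) (auto intro!: finsum_closed)
      also have "\<dots> = (X \<otimes>\<^bsub>matrix_ring m R\<^esub> (Y \<otimes>\<^bsub>matrix_ring m R\<^esub> Z)) $$ (i, j)"
        using ij X Y Z by (auto intro!: finsum_cong' finsum_closed)
      finally show "(X \<otimes>\<^bsub>matrix_ring m R\<^esub> Y \<otimes>\<^bsub>matrix_ring m R\<^esub> Z) $$ (i, j) =
        (X \<otimes>\<^bsub>matrix_ring m R\<^esub> (Y \<otimes>\<^bsub>matrix_ring m R\<^esub> Z)) $$ (i, j)" .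
    qed auto
  next
    fix X assume X: "X \<in> carrier (matrix_ring m R)"
    have "(\<Oplus>k\<in>{..<m}. (if i = k then \<one> else \<zero>) \<otimes> X $$ (k, j)) = X $$ (i, j)" if "i < m" "j < m" for i j
    proof -
      have "(\<Oplus>k\<in>{..<m}. (if i = k then \<one> else \<zero>) \<otimes> X $$ (k, j)) =
          (\<Oplus>k\<in>{..<m}. if k = i then X $$ (k, j) else \<zero>)"
        using X that by (intro finsum_cong') (auto simp: carrier_matrix_ring)
      then show ?thesis using X that by (simp add: finsum_delta_left carrier_matrix_ring)
    qed
    then show "\<one>\<^bsub>matrix_ring m R\<^esub> \<otimes>\<^bsub>matrix_ring m R\<^esub> X = X"
      using X by (intro eq_matI) (auto simp: carrier_matrix_ring cong: finsum_cong)
    have "(\<Oplus>k\<in>{..<m}. X $$ (i, k) \<otimes> (if k = j then \<one> else \<zero>)) = X $$ (i, j)" if "i < m" "j < m" for i j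
    proof -
      have "(\<Oplus>k\<in>{..<m}. X $$ (i, k) \<otimes> (if k = j then \<one> else \<zero>)) =
          (\<Oplus>k\<in>{..<m}. if k = j then X $$ (i, k) else \<zero>)"
        using X that by (intro finsum_cong') (auto simp: carrier_matrix_ring)
      then show ?thesis using X that by (simp add: finsum_delta_left carrier_matrix_ring)
    qed
    then show "X \<otimes>\<^bsub>matrix_ring m R\<^esub> \<one>\<^bsub>matrix_ring m R\<^esub> = X"
      using X by (intro eq_matI) (auto simp: carrier_matrix_ring cong: finsum_cong)
  qed (auto simp: carrier_matrix_ring)
next
  fix X Y Z assume "X \<in> carrier (matrix_ring m R)" "Y \<in> carrier (matrix_ring m R)"
      "Z \<in> carrier (matrix_ring m R)"
  then show "(X \<oplus>\<^bsub>matrix_ring m R\<^esub> Y) \<otimes>\<^bsub>matrix_ring m R\<^esub> Z =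
      X \<otimes>\<^bsub>matrix_ring m R\<^esub> Z \<oplus>\<^bsub>matrix_ring m R\<^esub> Y \<otimes>\<^bsub>matrix_ring m R\<^esub> Z"
    "Z \<otimes>\<^bsub>matrix_ring m R\<^esub> (X \<oplus>\<^bsub>matrix_ring m R\<^esub> Y) =
      Z \<otimes>\<^bsub>matrix_ring m R\<^esub> X \<oplus>\<^bsub>matrix_ring m R\<^esub> Z \<otimes>\<^bsub>matrix_ring m R\<^esub> Y"
    by (auto simp: carrier_matrix_ring l_distr r_distr Pi_def simp flip: finsum_addf
        intro!: eq_matI finsum_cong')
qed

text \<open>Reading off one entry is a homomorphism of additive groups, so it commutes with
  sums.\<close>

lemma index_finsum_matrix_ring:
  assumes "\<And>p. p \<in> P \<Longrightarrow> X p \<in> carrier (matrix_ring m R)" "i < m" "j < m"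
  shows "(\<Oplus>\<^bsub>matrix_ring m R\<^esub>p\<in>P. X p) $$ (i, j) = (\<Oplus>p\<in>P. X p $$ (i, j))"
proof (rule abelian_group_hom.hom_finsum)
  show "abelian_group_hom (matrix_ring m R) R (\<lambda>X. X $$ (i, j))"
    using assms ring_matrix_ring ring_axioms
    by (intro abelian_group_homI) (auto simp: carrier_matrix_ring ring_def)
qed (use assms in auto)

end

section \<open>Multiples of matrix units\<close>

definition single_mat :: "('a, 'r) ring_scheme \<Rightarrow> nat \<Rightarrow> nat \<Rightarrow> nat \<Rightarrow> 'a \<Rightarrow> 'a mat" where
  "single_mat R m u v a = mat m m (\<lambda>(i, j). if i = u \<and> j = v then a else \<zero>\<^bsub>R\<^esub>)"

context ring
begin

lemma single_mat_closed: "a \<in> carrier R \<Longrightarrow> single_mat R m u v a \<in> carrier (matrix_ring m R)"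
  by (auto simp: carrier_matrix_ring single_mat_def)

text \<open>In each entry only the summand for \<open>u\<close> can survive, so column
  \<open>u\<close> of \<open>X\<close>, multiplied by \<open>a\<close> from the right, lands in
  column \<open>v\<close>.\<close>

lemma mult_single_mat:
  assumes "X \<in> carrier (matrix_ring m R)" "a \<in> carrier R" "u < m"
  shows "X \<otimes>\<^bsub>matrix_ring m R\<^esub> single_mat R m u v a =
    mat m m (\<lambda>(i, j). if j = v then X $$ (i, u) \<otimes> a else \<zero>)"
proof (intro eq_matI)
  fix i j assume "i < dim_row (mat m m (\<lambda>(i, j). if j = v then X $$ (i, u) \<otimes> a else \<zero>))"
    "j < dim_col (mat m m (\<lambda>(i, j). if j = v then X $$ (i, u) \<otimes> a else \<zero>))"
  then have ij: "i < m" "j < m" by auto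
  then have "(X \<otimes>\<^bsub>matrix_ring m R\<^esub> single_mat R m u v a) $$ (i, j) =
      (\<Oplus>k\<in>{..<m}. if k = u then (if j = v then X $$ (i, k) \<otimes> a else \<zero>) else \<zero>)"
    using assms by (auto simp: single_mat_def carrier_matrix_ring intro!: finsum_cong')
  also have "\<dots> = (if j = v then X $$ (i, u) \<otimes> a else \<zero>)"
    using assms ij by (subst finsum_delta_left) (auto simp: carrier_matrix_ring)
  finally show "(X \<otimes>\<^bsub>matrix_ring m R\<^esub> single_mat R m u v a) $$ (i, j) =
      mat m m (\<lambda>(i, j). if j = v then X $$ (i, u) \<otimes> a else \<zero>) $$ (i, j)"
    using ij by simp
qed auto

lemma single_mat_mult:
  assumes "X \<in> carrier (matrix_ring m R)" "a \<in> carrier R" "v < m"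
  shows "single_mat R m u v a \<otimes>\<^bsub>matrix_ring m R\<^esub> X =
    mat m m (\<lambda>(i, j). if i = u then a \<otimes> X $$ (v, j) else \<zero>)"
proof (intro eq_matI)
  fix i j assume "i < dim_row (mat m m (\<lambda>(i, j). if i = u then a \<otimes> X $$ (v, j) else \<zero>))"
    "j < dim_col (mat m m (\<lambda>(i, j). if i = u then a \<otimes> X $$ (v, j) else \<zero>))"
  then have ij: "i < m" "j < m" by auto
  then have "(single_mat R m u v a \<otimes>\<^bsub>matrix_ring m R\<^esub> X) $$ (i, j) =
      (\<Oplus>k\<in>{..<m}. if k = v then (if i = u then a \<otimes> X $$ (k, j) else \<zero>) else \<zero>)"
    using assms by (auto simp: single_mat_def carrier_matrix_ring intro!: finsum_cong')
  also have "\<dots> = (if i = u then a \<otimes> X $$ (v, j) else \<zero>)"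
    using assms ij by (subst finsum_delta_left) (auto simp: carrier_matrix_ring)
  finally show "(single_mat R m u v a \<otimes>\<^bsub>matrix_ring m R\<^esub> X) $$ (i, j) =
      mat m m (\<lambda>(i, j). if i = u then a \<otimes> X $$ (v, j) else \<zero>) $$ (i, j)"
    using ij by simp
qed auto

end

section \<open>Entrywise maps and the Frobenius system of the matrix rings\<close>

lemma (in ring_hom_ring) ring_hom_ring_map_mat:
  "ring_hom_ring (matrix_ring m R) (matrix_ring m S) (map_mat h)"
proof (rule ring_hom_ringI)
  fix X Y assume X: "X \<in> carrier (matrix_ring m R)" and Y: "Y \<in> carrier (matrix_ring m R)"
  show "map_mat h (X \<otimes>\<^bsub>matrix_ring m R\<^esub> Y) = map_mat h X \<otimes>\<^bsub>matrix_ring m S\<^esub> map_mat h Y"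
  proof (intro eq_matI)
    fix i j assume "i < dim_row (map_mat h X \<otimes>\<^bsub>matrix_ring m S\<^esub> map_mat h Y)"
      "j < dim_col (map_mat h X \<otimes>\<^bsub>matrix_ring m S\<^esub> map_mat h Y)"
    then have ij: "i < m" "j < m" by auto
    then have "map_mat h (X \<otimes>\<^bsub>matrix_ring m R\<^esub> Y) $$ (i, j) =
        (\<Oplus>\<^bsub>S\<^esub>k\<in>{..<m}. h (X $$ (i, k) \<otimes> Y $$ (k, j)))"
      using X Y by (auto simp: carrier_matrix_ring intro!: hom_finsum)
    also have "\<dots> = (map_mat h X \<otimes>\<^bsub>matrix_ring m S\<^esub> map_mat h Y) $$ (i, j)"
      using ij X Y by (auto simp: carrier_matrix_ring intro!: S.finsum_cong')
    finally show "map_mat h (X \<otimes>\<^bsub>matrix_ring m R\<^esub> Y) $$ (i, j) =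
      (map_mat h X \<otimes>\<^bsub>matrix_ring m S\<^esub> map_mat h Y) $$ (i, j)" .
  qed auto
  show "map_mat h (X \<oplus>\<^bsub>matrix_ring m R\<^esub> Y) = map_mat h X \<oplus>\<^bsub>matrix_ring m S\<^esub> map_mat h Y"
    using X Y by (intro eq_matI) (auto simp: carrier_matrix_ring)
qed (auto simp: R.ring_matrix_ring S.ring_matrix_ring intro!: map_mat_carrier_matrix_ring eq_matI)

lemma (in frobenius_system) abelian_group_hom_E: "abelian_group_hom A R E"
  by (intro abelian_group_homI) (auto simp: E_closed E_add R.abelian_group_axioms S.abelian_group_axioms)

text \<open>
  One column of matrix units suffices: right multiplication by \<open>y\<^sub>i e\<^sub>k\<^sub>0\<close> moves column \<open>k\<close> of a matrix
  to column \<open>0\<close>, and right multiplication by \<open>x\<^sub>i e\<^sub>0\<^sub>k\<close> moves it back.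
\<close>

lemma (in frobenius_system) frobenius_system_matrix_ring:
  assumes "0 < m"
  shows "frobenius_system (matrix_ring m R) (matrix_ring m A) (map_mat \<iota>) (I \<times> {..<m}) (map_mat E)
    (\<lambda>(i, k). single_mat A m 0 k (x i)) (\<lambda>(i, k). single_mat A m k 0 (y i))"
proof -
  interpret E: abelian_group_hom A R E by (rule abelian_group_hom_E)
  let ?R = "matrix_ring m R" and ?A = "matrix_ring m A"
  interpret mat: ring_hom_ring ?R ?A "map_mat \<iota>" by (rule ring_hom_ring_map_mat)
  show ?thesis
  \<comment> \<open>The goals follow the axioms of \<open>frobenius_system\<close>: 5 is additivity,
    6 and 7 are left and right linearity, 8 and 9 the two expansions. Finiteness and the closure
    conditions are left to the end.\<close>
  proof (unfold_locales, goal_cases)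
    case (5 X Y)
    then show ?case by (intro eq_matI) (auto simp: carrier_matrix_ring E_add)
  next
    case (6 P X)
    note cPX = 6[unfolded carrier_matrix_ring]
    show ?case
    proof (intro eq_matI)
      fix i j assume "i < dim_row (P \<otimes>\<^bsub>?R\<^esub> map_mat E X)" "j < dim_col (P \<otimes>\<^bsub>?R\<^esub> map_mat E X)"
      then have ij: "i < m" "j < m" by auto
      \<comment> \<open>Additivity moves \<open>E\<close> through the sum that defines the entry;
        left linearity of the original \<open>E\<close> then treats each summand.\<close>
      then have "map_mat E (map_mat \<iota> P \<otimes>\<^bsub>?A\<^esub> X) $$ (i, j) =
          (\<Oplus>\<^bsub>R\<^esub>k\<in>{..<m}. E ((map_mat \<iota> P) $$ (i, k) \<otimes>\<^bsub>A\<^esub> X $$ (k, j)))"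
        using cPX by (auto intro!: E.hom_finsum)
      also have "\<dots> = (P \<otimes>\<^bsub>?R\<^esub> map_mat E X) $$ (i, j)"
        using ij cPX by (auto simp: E_left intro!: R.finsum_cong')
      finally show "map_mat E (map_mat \<iota> P \<otimes>\<^bsub>?A\<^esub> X) $$ (i, j) = (P \<otimes>\<^bsub>?R\<^esub> map_mat E X) $$ (i, j)" .
    qed auto
  next
    case (7 P X)
    note cPX = 7[unfolded carrier_matrix_ring]
    show ?case
    proof (intro eq_matI)
      fix i j assume "i < dim_row (map_mat E X \<otimes>\<^bsub>?R\<^esub> P)" "j < dim_col (map_mat E X \<otimes>\<^bsub>?R\<^esub> P)"
      then have ij: "i < m" "j < m" by auto
      then have "map_mat E (X \<otimes>\<^bsub>?A\<^esub> map_mat \<iota> P) $$ (i, j) =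
          (\<Oplus>\<^bsub>R\<^esub>k\<in>{..<m}. E (X $$ (i, k) \<otimes>\<^bsub>A\<^esub> (map_mat \<iota> P) $$ (k, j)))"
        using cPX by (auto intro!: E.hom_finsum)
      also have "\<dots> = (map_mat E X \<otimes>\<^bsub>?R\<^esub> P) $$ (i, j)"
        using ij cPX by (auto simp: E_right intro!: R.finsum_cong')
      finally show "map_mat E (X \<otimes>\<^bsub>?A\<^esub> map_mat \<iota> P) $$ (i, j) = (map_mat E X \<otimes>\<^bsub>?R\<^esub> P) $$ (i, j)" .
    qed auto
  next
    case (8 X)
    note cX = 8[unfolded carrier_matrix_ring]
    \<comment> \<open>Each index pair contributes to column \<open>k\<close> alone. Column 0, the
      intermediate stop, exists because \<open>0 < m\<close>.\<close>
    have T: "map_mat \<iota> (map_mat E (X \<otimes>\<^bsub>?A\<^esub> single_mat A m k 0 (y i))) \<otimes>\<^bsub>?A\<^esub> single_mat A m 0 k (x i) =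
        mat m m (\<lambda>(p, q). if q = k then \<iota> (E (X $$ (p, k) \<otimes>\<^bsub>A\<^esub> y i)) \<otimes>\<^bsub>A\<^esub> x i else \<zero>\<^bsub>A\<^esub>)"
      if "i \<in> I" "k < m" for i k
    proof -
      have "X \<otimes>\<^bsub>?A\<^esub> single_mat A m k 0 (y i) \<in> carrier ?A"
        using 8 that by (intro mat.S.m_closed S.single_mat_closed y_closed)
      then have "map_mat \<iota> (map_mat E (X \<otimes>\<^bsub>?A\<^esub> single_mat A m k 0 (y i))) \<in> carrier ?A"
        by (intro map_mat_carrier_matrix_ring[of _ m R _ A] map_mat_carrier_matrix_ring[of _ m A _ R])
          (simp_all add: E_closed)
      then show ?thesis
        using assms that 8
        by (subst S.mult_single_mat) (auto simp: S.mult_single_mat x_closed y_closed intro!: eq_matI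
            simp del: matrix_ring_simps)
    qed
    have c: "mat m m (\<lambda>(p, q). if q = k then \<iota> (E (X $$ (p, k) \<otimes>\<^bsub>A\<^esub> y i)) \<otimes>\<^bsub>A\<^esub> x i else \<zero>\<^bsub>A\<^esub>) \<in> carrier ?A"
      if "i \<in> I" "k < m" for i k
      using that cX by (auto simp: carrier_matrix_ring x_closed y_closed E_closed)
    let ?s = "\<Oplus>\<^bsub>?A\<^esub>p\<in>I \<times> {..<m}. map_mat \<iota> (map_mat E (X \<otimes>\<^bsub>?A\<^esub> (case p of (i, k) \<Rightarrow> single_mat A m k 0 (y i))))
      \<otimes>\<^bsub>?A\<^esub> (case p of (i, k) \<Rightarrow> single_mat A m 0 k (x i))"
    show ?case
    proof (rule matrix_ring_eqI)
      show "?s \<in> carrier ?A"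
        using c by (intro mat.S.finsum_closed) (auto simp: T simp del: matrix_ring_simps)
    next
      fix r q assume rq: "r < m" "q < m"
      have "?s $$ (r, q) = (\<Oplus>\<^bsub>A\<^esub>p\<in>I \<times> {..<m}.
          if q = snd p then \<iota> (E (X $$ (r, snd p) \<otimes>\<^bsub>A\<^esub> y (fst p))) \<otimes>\<^bsub>A\<^esub> x (fst p) else \<zero>\<^bsub>A\<^esub>)"
        using c rq cX
        by (subst S.index_finsum_matrix_ring)
          (auto simp: T x_closed y_closed E_closed simp del: matrix_ring_simps intro!: S.finsum_cong')
      \<comment> \<open>At position \<open>(r, q)\<close> only \<open>k = q\<close> contributes,
        which leaves the left expansion of the single entry \<open>X $$ (r, q)\<close> over
        \<open>A\<close>.\<close>
      also have "\<dots> = (\<Oplus>\<^bsub>A\<^esub>i\<in>I. \<Oplus>\<^bsub>A\<^esub>k\<in>{..<m}.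
          if k = q then \<iota> (E (X $$ (r, k) \<otimes>\<^bsub>A\<^esub> y i)) \<otimes>\<^bsub>A\<^esub> x i else \<zero>\<^bsub>A\<^esub>)"
        using cX rq finite_index
        by (subst S.finsum_Times) (auto simp: x_closed y_closed E_closed intro!: S.finsum_cong' S.finsum_closed)
      also have "\<dots> = (\<Oplus>\<^bsub>A\<^esub>i\<in>I. \<iota> (E (X $$ (r, q) \<otimes>\<^bsub>A\<^esub> y i)) \<otimes>\<^bsub>A\<^esub> x i)"
        using cX rq
        by (intro S.finsum_cong') (auto simp: S.finsum_delta_left x_closed y_closed E_closed)
      finally show "?s $$ (r, q) = X $$ (r, q)" using cX rq by (simp add: expand_left)
    qed (rule 8)
  next
    case (9 X)
    note cX = 9[unfolded carrier_matrix_ring]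
    \<comment> \<open>The mirror image with rows: left multiplication by
      \<open>x\<^sub>i e\<^sub>0\<^sub>k\<close> moves row \<open>k\<close> to row 0, and left
      multiplication by \<open>y\<^sub>i e\<^sub>k\<^sub>0\<close> moves it back.\<close>
    have T: "single_mat A m k 0 (y i) \<otimes>\<^bsub>?A\<^esub> map_mat \<iota> (map_mat E (single_mat A m 0 k (x i) \<otimes>\<^bsub>?A\<^esub> X)) =
        mat m m (\<lambda>(p, q). if p = k then y i \<otimes>\<^bsub>A\<^esub> \<iota> (E (x i \<otimes>\<^bsub>A\<^esub> X $$ (k, q))) else \<zero>\<^bsub>A\<^esub>)"
      if "i \<in> I" "k < m" for i k
    proof -
      have "single_mat A m 0 k (x i) \<otimes>\<^bsub>?A\<^esub> X \<in> carrier ?A"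
        using 9 that by (intro mat.S.m_closed S.single_mat_closed x_closed)
      then have "map_mat \<iota> (map_mat E (single_mat A m 0 k (x i) \<otimes>\<^bsub>?A\<^esub> X)) \<in> carrier ?A"
        by (intro map_mat_carrier_matrix_ring[of _ m R _ A] map_mat_carrier_matrix_ring[of _ m A _ R])
          (simp_all add: E_closed)
      then show ?thesis
        using assms that 9
        by (subst S.single_mat_mult) (auto simp: S.single_mat_mult x_closed y_closed intro!: eq_matI
            simp del: matrix_ring_simps)
    qed
    have c: "mat m m (\<lambda>(p, q). if p = k then y i \<otimes>\<^bsub>A\<^esub> \<iota> (E (x i \<otimes>\<^bsub>A\<^esub> X $$ (k, q))) else \<zero>\<^bsub>A\<^esub>) \<in> carrier ?A"
      if "i \<in> I" "k < m" for i k
      using that cX by (auto simp: carrier_matrix_ring x_closed y_closed E_closed)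
    let ?s = "\<Oplus>\<^bsub>?A\<^esub>p\<in>I \<times> {..<m}. (case p of (i, k) \<Rightarrow> single_mat A m k 0 (y i)) \<otimes>\<^bsub>?A\<^esub>
      map_mat \<iota> (map_mat E ((case p of (i, k) \<Rightarrow> single_mat A m 0 k (x i)) \<otimes>\<^bsub>?A\<^esub> X))"
    show ?case
    proof (rule matrix_ring_eqI)
      show "?s \<in> carrier ?A"
        using c by (intro mat.S.finsum_closed) (auto simp: T simp del: matrix_ring_simps)
    next
      fix r q assume rq: "r < m" "q < m"
      have "?s $$ (r, q) = (\<Oplus>\<^bsub>A\<^esub>p\<in>I \<times> {..<m}.
          if r = snd p then y (fst p) \<otimes>\<^bsub>A\<^esub> \<iota> (E (x (fst p) \<otimes>\<^bsub>A\<^esub> X $$ (snd p, q))) else \<zero>\<^bsub>A\<^esub>)"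
        using c rq cX
        by (subst S.index_finsum_matrix_ring)
          (auto simp: T x_closed y_closed E_closed simp del: matrix_ring_simps intro!: S.finsum_cong')
      also have "\<dots> = (\<Oplus>\<^bsub>A\<^esub>i\<in>I. \<Oplus>\<^bsub>A\<^esub>k\<in>{..<m}.
          if k = r then y i \<otimes>\<^bsub>A\<^esub> \<iota> (E (x i \<otimes>\<^bsub>A\<^esub> X $$ (k, q))) else \<zero>\<^bsub>A\<^esub>)"
        using cX rq finite_index
        by (subst S.finsum_Times) (auto simp: x_closed y_closed E_closed intro!: S.finsum_cong' S.finsum_closed)
      also have "\<dots> = (\<Oplus>\<^bsub>A\<^esub>i\<in>I. y i \<otimes>\<^bsub>A\<^esub> \<iota> (E (x i \<otimes>\<^bsub>A\<^esub> X $$ (r, q))))"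
        using cX rq
        by (intro S.finsum_cong') (auto simp: S.finsum_delta_left x_closed y_closed E_closed)
      finally show "?s $$ (r, q) = X $$ (r, q)" using cX rq by (simp add: expand_right)
    qed (rule 9)
  qed (auto simp: finite_index intro!: S.single_mat_closed x_closed y_closed map_mat_carrier_matrix_ring E_closed)
qed

theorem corollary3p6:
  fixes R :: "('r, 'q) ring_scheme"
    and A :: "('a, 'p) ring_scheme"
    and \<iota> :: "'r \<Rightarrow> 'a"
    and m :: nat
  assumes "frobenius_extension R A \<iota>"
    and "m \<ge> 1"
  shows "frobenius_extension (matrix_ring m R) (matrix_ring m A) (map_mat \<iota>)"
proof -
  obtain I :: "'a set" and E x y where "frobenius_system R A \<iota> I E x y"
    using frobenius_extension_imp_frobenius_system[OF assms(1)] by blast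
  then show ?thesis
    using frobenius_system.frobenius_extension[OF frobenius_system.frobenius_system_matrix_ring]
      assms(2) by fastforce
qed

end
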